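(* Let $\rho>0$ and $\alpha>2$, let $E$ be an exponential random variable with mean one, and let the edge weights of the complete graph $K_n$ satisfy $X_e\overset{d}{=}e^{-(E/\rho)^{1/\alpha}}$. Then \[ u_n=e^{-(\log n/\rho)^{1/\alpha}} \] and, with $s_n=\frac{1}{\alpha\rho^{1/\alpha}}(\log n)^{-1+1/\alpha}$, \[ \frac{W_n}{u_n s_n\log n}\overset{\mathbb{P}}{\longrightarrow}e\qquad\text{as }n\to\infty. \] Moreover, \[ \frac{H_n}{s_n\log n}\overset{\mathbb{P}}{\longrightarrow}1\qquad\text{as }n\to\infty. \]
   Context: For each $n$, let $K_n$ be the complete graph with vertex set $[n]=\{1,\dots,n\}$ and edge set $\mathrm{E}_n$. The edge weights $(X_e)_{e\in \mathrm{E}_n}$ are positive i.i.d. random variables with continuous distribution function $F_n$. The weight of a path $p$ is $w(p)=\sum_{e\in p}X_e$. Let $\mathcal{S}_{1,2}$ be the set of self-avoiding paths between vertex $1$ and vertex $2$. $W_n=\min_{p\in\mathcal{S}_{1,2}}w(p)$ is the weight of the (almost surely unique) minimal weight path, and the hopcount $H_n$ is its number of edges. $u_n$ denotes the unique positive value with $nF_n(u_n)=1$. *)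

theory Defs
  imports "HOL-Probability.Probability"
begin

definition complete_edges :: "nat \<Rightarrow> nat set set" where
  "complete_edges n = {e. e \<subseteq> {1..n} \<and> card e = 2}"

text \<open>Paths are represented by their lists of vertices.\<close>

definition path_edges :: "'v list \<Rightarrow> 'v set list" where
  "path_edges p = map (\<lambda>(u, v). {u, v}) (zip p (tl p))"

definition self_avoiding_paths :: "nat \<Rightarrow> nat \<Rightarrow> nat \<Rightarrow> nat list set" where
  "self_avoiding_paths n a b =
     {p. p \<noteq> [] \<and> hd p = a \<and> last p = b \<and> distinct p \<and>
         set p \<subseteq> {1..n} \<and> set (path_edges p) \<subseteq> complete_edges n}"

definition path_weight :: "('v set \<Rightarrow> real) \<Rightarrow> 'v list \<Rightarrow> real" where
  "path_weight x p = (\<Sum>e\<leftarrow>path_edges p. x e)"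

definition min_weight :: "nat \<Rightarrow> (nat set \<Rightarrow> real) \<Rightarrow> real" where
  "min_weight n x = Min (path_weight x ` self_avoiding_paths n 1 2)"

text \<open>
  If several paths have minimal weight, \<open>arg_min_on\<close> selects one of them. The choice depends
  only on the set of minimising paths, and for independent weights with continuous distribution
  functions ties have probability zero.
\<close>

definition hopcount :: "nat \<Rightarrow> (nat set \<Rightarrow> real) \<Rightarrow> nat" where
  "hopcount n x =
     length (path_edges (arg_min_on (path_weight x) (self_avoiding_paths n 1 2)))"

text \<open>
  The value \<open>u\<^sub>n\<close> attached to a distribution function \<open>F\<close>; meaningful only where the solution
  exists and is unique.
\<close>

definition critical_value :: "nat \<Rightarrow> (real \<Rightarrow> real) \<Rightarrow> real" where
  "critical_value n F = (THE u. 0 < u \<and> real n * F u = 1)"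

text \<open>
  Convergence in probability to a constant; the random variables may live on different
  probability spaces. Measurability is part of the notion, because the measure of a
  non-measurable set is \<open>0\<close> by convention.
\<close>

definition tendsto_in_prob ::
  "(nat \<Rightarrow> 'a measure) \<Rightarrow> (nat \<Rightarrow> 'a \<Rightarrow> real) \<Rightarrow> real \<Rightarrow> bool" where
  "tendsto_in_prob M Y c \<longleftrightarrow>
     (\<forall>n. Y n \<in> borel_measurable (M n)) \<and>
     (\<forall>\<epsilon>>0. (\<lambda>n. measure (M n) {\<omega> \<in> space (M n). \<bar>Y n \<omega> - c\<bar> > \<epsilon>}) \<longlonglongrightarrow> 0)"

end

theory Submission
  imports Defs "HOL-Real_Asymp.Real_Asymp"
begin

text \<open>
  Write \<open>l = ln n\<close>, \<open>a = 1 / s\<^sub>n\<close> and \<open>h = s\<^sub>n l\<close>, so that \<open>a h = l\<close>.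

  Lower bound and hopcount: by convexity of \<open>y \<mapsto> y\<^sup>\<alpha>\<close> the rescaled weight \<open>X / u\<^sub>n\<close> is at least \<open>(n U)\<close> to
  the power \<open>s\<^sub>n\<close> with \<open>U\<close> uniform. Its Laplace transform at \<open>(a / e) exp \<eta>\<close> is therefore \<open>exp (- a \<eta>) / n\<close>
  up to a factor polynomial in \<open>l\<close>, and Markov's inequality summed over all paths shows that a
  path of weight at most \<open>c e u\<^sub>n h\<close> with at least (for \<open>\<eta> > 0\<close>) or at most (for \<open>\<eta> < 0\<close>) \<open>R h\<close> edges
  exists with probability at most \<open>n\<close> to the power \<open>c exp \<eta> - 1 - R \<eta> + o(1)\<close>. The choice \<open>R = 0\<close>, \<open>c < 1\<close> and
  a small \<open>\<eta> > 0\<close> bounds \<open>W\<^sub>n\<close> below; \<open>R = 1 \<plusminus> \<delta>\<close>, \<open>\<eta> = ln R\<close> and \<open>c\<close> slightly above 1 localises \<open>H\<^sub>n\<close>.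

  Upper bound: for \<open>b > e\<close> the edges of weight at most \<open>b u\<^sub>n\<close> form a random graph whose mean degree
  is \<open>exp (a ln b (1 + o(1)))\<close>. Splitting the vertices into layers, the second moment method gives a path
  from 1 to 2 through the layers with \<open>\<lceil>h\<rceil>\<close> such edges, of weight at most \<open>b u\<^sub>n \<lceil>h\<rceil>\<close>.
\<close>

section \<open>Self-avoiding paths\<close>

lemma path_edges_simps [simp]:
  "path_edges [] = []" "path_edges [x] = []"
  "path_edges (x # y # zs) = {x, y} # path_edges (y # zs)"
  by (simp_all add: path_edges_def)

lemma length_path_edges: "length (path_edges p) = length p - 1"
  by (simp add: path_edges_def)

lemma path_edges_subset: "e \<in> set (path_edges p) \<Longrightarrow> e \<subseteq> set p"
  by (induction p rule: induct_list012) auto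

lemma distinct_path_edges: "distinct p \<Longrightarrow> distinct (path_edges p)"
proof (induction p rule: induct_list012)
  case (3 x y zs)
  then show ?case using path_edges_subset[of "{x, y}" "y # zs"] by auto
qed auto

lemma path_edges_complete:
  "distinct p \<Longrightarrow> set p \<subseteq> {1..n} \<Longrightarrow> set (path_edges p) \<subseteq> complete_edges n"
proof (induction p rule: induct_list012)
  case (3 x y zs)
  then show ?case by (auto simp: complete_edges_def)
qed auto

lemma finite_complete_edges [simp]: "finite (complete_edges n)"
  by (rule finite_subset[of _ "Pow {1..n}"]) (auto simp: complete_edges_def)

lemma distinct_length_le: "distinct p \<Longrightarrow> set p \<subseteq> {1..n} \<Longrightarrow> length p \<le> n"
  using card_mono[of "{1..n}" "set p"] by (simp add: distinct_card)

lemma finite_self_avoiding_paths [simp]: "finite (self_avoiding_paths n a b)"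
proof (rule finite_subset)
  show "self_avoiding_paths n a b \<subseteq> {xs. set xs \<subseteq> {1..n} \<and> length xs \<le> n}"
    by (simp add: self_avoiding_paths_def distinct_length_le subset_iff)
  show "finite {xs. set xs \<subseteq> {1..n} \<and> length xs \<le> n}"
    by (rule finite_lists_length_le) simp
qed

text \<open>Distinct neighbouring vertices in range already form an edge of the complete graph, so
  the edge condition in the definition never has to be checked by hand.\<close>

lemma self_avoiding_paths_I:
  "\<lbrakk>p \<noteq> []; hd p = a; last p = b; distinct p; set p \<subseteq> {1..n}\<rbrakk> \<Longrightarrow> p \<in> self_avoiding_paths n a b"
  by (simp add: self_avoiding_paths_def path_edges_complete)

lemma self_avoiding_paths_nonempty: "n \<ge> 2 \<Longrightarrow> self_avoiding_paths n 1 2 \<noteq> {}"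
proof -
  assume "n \<ge> 2"
  then have "[1, 2] \<in> self_avoiding_paths n 1 2"
    by (intro self_avoiding_paths_I) auto
  then show ?thesis by blast
qed

lemma self_avoiding_path_form:
  assumes "p \<in> self_avoiding_paths n 1 2"
  obtains q where "p = 1 # q @ [2]" "set q \<subseteq> {1..n}" "length (path_edges p) = Suc (length q)"
proof -
  from assms have p: "p \<noteq> []" "hd p = 1" "last p = 2" "set p \<subseteq> {1..n}"
    by (auto simp: self_avoiding_paths_def)
  then obtain r where r: "p = 1 # r" by (cases p) auto
  with p have "r \<noteq> []" by auto
  then obtain q where "r = q @ [2]" using p r by (metis append_butlast_last_id last_ConsR)
  with p r have "p = 1 # q @ [2]" "set q \<subseteq> {1..n}" "length (path_edges p) = Suc (length q)"
    by (auto simp: length_path_edges)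
  then show ?thesis using that by blast
qed

lemma length_path_edges_bounds:
  assumes "p \<in> self_avoiding_paths n 1 2"
  shows "length (path_edges p) \<in> {1..n}"
proof -
  have "length p \<le> n"
    using assms by (simp add: self_avoiding_paths_def distinct_length_le)
  moreover obtain q where "p = 1 # q @ [2]" using self_avoiding_path_form[OF assms] by blast
  ultimately show ?thesis by (simp add: length_path_edges)
qed

text \<open>A path with \<open>k\<close> edges is determined by its \<open>k - 1\<close> interior
  vertices. The missing power of \<open>n\<close> is the source of the factor \<open>1 / n\<close>
  in the first moment bound.\<close>

lemma card_self_avoiding_paths_length:
  assumes "k \<ge> 1"
  shows "card {p \<in> self_avoiding_paths n 1 2. length (path_edges p) = k} \<le> n ^ (k - 1)"
proof -
  have "{p \<in> self_avoiding_paths n 1 2. length (path_edges p) = k}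
      \<subseteq> (\<lambda>q. 1 # q @ [2]) ` {q. set q \<subseteq> {1..n} \<and> length q = k - 1}"
  proof safe
    fix p assume "p \<in> self_avoiding_paths n 1 2" "k = length (path_edges p)"
    then show "p \<in> (\<lambda>q. 1 # q @ [2]) ` {q. set q \<subseteq> {1..n} \<and> length q = length (path_edges p) - 1}"
      by (elim self_avoiding_path_form) auto
  qed
  then have "card {p \<in> self_avoiding_paths n 1 2. length (path_edges p) = k}
      \<le> card {q. set q \<subseteq> {1..n} \<and> length q = k - 1}"
    by (intro surj_card_le finite_lists_length_eq) auto
  then show ?thesis by (simp add: card_lists_length_eq)
qed

lemma path_weight_eq_sum: "distinct p \<Longrightarrow> path_weight x p = (\<Sum>e\<in>set (path_edges p). x e)"
  unfolding path_weight_def by (simp add: distinct_path_edges sum_list_distinct_conv_sum_set)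

text \<open>One path realises both quantities, so events about the minimal weight and the hopcount
  turn into the existence of a path of given weight and length.\<close>

lemma hopcount_minimal:
  assumes "n \<ge> 2"
  obtains p where "p \<in> self_avoiding_paths n 1 2" "path_weight x p = min_weight n x"
    "length (path_edges p) = hopcount n x"
proof -
  define S where "S = self_avoiding_paths n 1 2"
  have S: "finite S" "S \<noteq> {}" using self_avoiding_paths_nonempty[OF assms] by (auto simp: S_def)
  define p where "p = arg_min_on (path_weight x) S"
  have p: "p \<in> S" "\<not> (\<exists>y\<in>S. path_weight x y < path_weight x p)"
    using arg_min_if_finite[OF S] by (auto simp: p_def)
  have "min_weight n x = path_weight x p"
    unfolding min_weight_def S_def[symmetric] using p S by (intro Min_eqI) (auto simp: not_less)
  with p show ?thesis by (intro that[of p]) (auto simp: S_def p_def hopcount_def)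
qed

lemma min_weight_le: "p \<in> self_avoiding_paths n 1 2 \<Longrightarrow> min_weight n x \<le> path_weight x p"
  unfolding min_weight_def by simp

section \<open>Measurability of the minimal weight and of the hopcount\<close>

lemma borel_measurable_path_weight:
  assumes "\<And>e. e \<in> complete_edges n \<Longrightarrow> X e \<in> borel_measurable M"
    and "p \<in> self_avoiding_paths n a b"
  shows "(\<lambda>\<omega>. path_weight (\<lambda>e. X e \<omega>) p) \<in> borel_measurable M"
proof -
  have "distinct p" "set (path_edges p) \<subseteq> complete_edges n"
    using assms(2) by (auto simp: self_avoiding_paths_def)
  then show ?thesis using assms(1) by (auto simp: path_weight_eq_sum intro!: borel_measurable_sum)
qed

lemma measurable_min_weight:
  assumes "\<And>e. e \<in> complete_edges n \<Longrightarrow> X e \<in> borel_measurable M"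
  shows "(\<lambda>\<omega>. min_weight n (\<lambda>e. X e \<omega>)) \<in> borel_measurable M"
  unfolding min_weight_def
  using borel_measurable_Min[OF finite_self_avoiding_paths borel_measurable_path_weight[OF assms]]
  by (simp add: image_image)

text \<open>The hopcount factors through the set of minimising paths, which takes finitely many values.\<close>

lemma measurable_hopcount:
  assumes "\<And>e. e \<in> complete_edges n \<Longrightarrow> X e \<in> borel_measurable M"
  shows "(\<lambda>\<omega>. real (hopcount n (\<lambda>e. X e \<omega>))) \<in> borel_measurable M"
proof -
  define S where "S = self_avoiding_paths n 1 2"
  define w where "w p \<omega> = path_weight (\<lambda>e. X e \<omega>) p" for p \<omega>
  define R where "R \<omega> = {p \<in> S. \<forall>q\<in>S. w p \<omega> \<le> w q \<omega>}" for \<omega>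
  have fin: "finite S" by (simp add: S_def)
  have wm: "w p \<in> borel_measurable M" if "p \<in> S" for p
    using that borel_measurable_path_weight[OF assms] by (simp add: S_def w_def[abs_def])
  have "R \<in> measurable M (count_space (Pow S))"
  proof (subst measurable_count_space_eq2)
    show "R \<in> space M \<rightarrow> Pow S \<and> (\<forall>T\<in>Pow S. R -` {T} \<inter> space M \<in> sets M)"
    proof (intro conjI ballI)
      fix T assume T: "T \<in> Pow S"
      \<comment> \<open>The event is a finite Boolean combination of comparisons between path
        weights.\<close>
      have "R -` {T} \<inter> space M =
        {\<omega> \<in> space M. \<forall>p\<in>S. (p \<in> T) = (\<forall>q\<in>S. w p \<omega> \<le> w q \<omega>)}"
      proof -
        have "R \<omega> = T \<longleftrightarrow> (\<forall>p\<in>S. (p \<in> T) = (\<forall>q\<in>S. w p \<omega> \<le> w q \<omega>))" for \<omega>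
          using T unfolding R_def by blast
        then show ?thesis by auto
      qed
      also have "\<dots> \<in> sets M"
      proof (intro sets.sets_Collect_finite_All fin)
        fix p assume p: "p \<in> S"
        have Q: "{\<omega> \<in> space M. \<forall>q\<in>S. w p \<omega> \<le> w q \<omega>} \<in> sets M"
          by (intro sets.sets_Collect_finite_All fin borel_measurable_le wm p)
        then show "{\<omega> \<in> space M. (p \<in> T) = (\<forall>q\<in>S. w p \<omega> \<le> w q \<omega>)} \<in> sets M"
          by (cases "p \<in> T") (simp_all only: simp_thms sets.sets_Collect_neg)
      qed
      finally show "R -` {T} \<inter> space M \<in> sets M" .
    qed (auto simp: R_def)
  qed (use fin in auto)
  \<comment> \<open>On a discrete space every function is measurable, so the arbitrary choice made
    by \<open>SOME\<close> does no harm.\<close>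
  moreover have "(\<lambda>T. real (length (path_edges (SOME p. p \<in> T)))) \<in> borel_measurable (count_space (Pow S))"
    by simp
  ultimately have "(\<lambda>\<omega>. real (length (path_edges (SOME p. p \<in> R \<omega>)))) \<in> borel_measurable M"
    by (rule measurable_compose)
  moreover have "hopcount n (\<lambda>e. X e \<omega>) = length (path_edges (SOME p. p \<in> R \<omega>))" for \<omega>
    unfolding hopcount_def arg_min_on_def arg_min_def is_arg_min_def S_def[symmetric]
    by (simp add: R_def w_def not_less Ball_def)
  ultimately show ?thesis by simp
qed

section \<open>First and second moment bounds\<close>

text \<open>Exponential Markov inequality. The edges of a self-avoiding path are distinct, so by
  independence the Laplace transform of its weight factorises.\<close>

lemma (in prob_space) prob_path_weight_le:
  fixes X :: "nat set \<Rightarrow> 'a \<Rightarrow> real"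
  assumes indep: "indep_vars (\<lambda>_. borel) X (complete_edges n)"
    and theta: "\<theta> \<ge> 0" and psi: "\<psi> \<ge> 0"
    and laplace: "\<And>e. e \<in> complete_edges n \<Longrightarrow>
      (\<integral>\<^sup>+\<omega>. ennreal (exp (- \<theta> * X e \<omega>)) \<partial>M) \<le> ennreal \<psi>"
    and p: "p \<in> self_avoiding_paths n a b"
  shows "prob {\<omega> \<in> space M. path_weight (\<lambda>e. X e \<omega>) p \<le> L}
    \<le> exp (\<theta> * L) * \<psi> ^ length (path_edges p)"
proof -
  define J where "J = set (path_edges p)"
  have J: "J \<subseteq> complete_edges n" "finite J" "card J = length (path_edges p)" "distinct p"
    using p by (auto simp: J_def self_avoiding_paths_def distinct_path_edges distinct_card)
  have X: "random_variable borel (X e)" if "e \<in> complete_edges n" for e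
    using indep that by (auto simp: indep_vars_def)
  have ind: "indep_vars (\<lambda>_. borel) (\<lambda>e \<omega>. ennreal (exp (- \<theta> * X e \<omega>))) J"
    by (rule indep_vars_compose2[OF indep_vars_subset[OF indep J(1)]]) simp
  have rv: "(\<lambda>\<omega>. path_weight (\<lambda>e. X e \<omega>) p) \<in> borel_measurable M"
    by (rule borel_measurable_path_weight[OF X p])
  then have ev: "{\<omega> \<in> space M. path_weight (\<lambda>e. X e \<omega>) p \<le> L} \<in> sets M" by measurable
  have "emeasure M {\<omega> \<in> space M. path_weight (\<lambda>e. X e \<omega>) p \<le> L}
      = (\<integral>\<^sup>+\<omega>. indicator {\<omega> \<in> space M. path_weight (\<lambda>e. X e \<omega>) p \<le> L} \<omega> \<partial>M)"
    using ev by simp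
  also have "\<dots> \<le> (\<integral>\<^sup>+\<omega>. ennreal (exp (\<theta> * L)) * (\<Prod>e\<in>J. ennreal (exp (- \<theta> * X e \<omega>))) \<partial>M)"
  proof (rule nn_integral_mono)
    fix \<omega>
    have "1 \<le> ennreal (exp (\<theta> * L)) * (\<Prod>e\<in>J. ennreal (exp (- \<theta> * X e \<omega>)))"
      if "path_weight (\<lambda>e. X e \<omega>) p \<le> L"
    proof -
      have "(\<Prod>e\<in>J. exp (- \<theta> * X e \<omega>)) = exp (- \<theta> * path_weight (\<lambda>e. X e \<omega>) p)"
        using J by (simp add: path_weight_eq_sum J_def[symmetric] exp_sum[symmetric] sum_distrib_left)
      moreover have "1 \<le> exp (\<theta> * L) * exp (- \<theta> * path_weight (\<lambda>e. X e \<omega>) p)"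
        using that theta by (simp add: exp_add[symmetric] mult_left_mono)
      ultimately show ?thesis
        by (simp add: prod_ennreal ennreal_mult[symmetric] prod_nonneg)
    qed
    then show "indicator {\<omega> \<in> space M. path_weight (\<lambda>e. X e \<omega>) p \<le> L} \<omega>
        \<le> ennreal (exp (\<theta> * L)) * (\<Prod>e\<in>J. ennreal (exp (- \<theta> * X e \<omega>)))"
      by (auto simp: indicator_def)
  qed
  also have "\<dots> = ennreal (exp (\<theta> * L)) * (\<Prod>e\<in>J. \<integral>\<^sup>+\<omega>. ennreal (exp (- \<theta> * X e \<omega>)) \<partial>M)"
  proof (subst nn_integral_cmult)
    show "(\<lambda>\<omega>. \<Prod>e\<in>J. ennreal (exp (- \<theta> * X e \<omega>))) \<in> borel_measurable M"
      using J X by (intro borel_measurable_prod_ennreal) auto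
    show "ennreal (exp (\<theta> * L)) * (\<integral>\<^sup>+\<omega>. (\<Prod>e\<in>J. ennreal (exp (- \<theta> * X e \<omega>))) \<partial>M)
      = ennreal (exp (\<theta> * L)) * (\<Prod>e\<in>J. \<integral>\<^sup>+\<omega>. ennreal (exp (- \<theta> * X e \<omega>)) \<partial>M)"
      using indep_vars_nn_integral[OF J(2) ind] by simp
  qed
  also have "\<dots> \<le> ennreal (exp (\<theta> * L)) * (\<Prod>e\<in>J. ennreal \<psi>)"
    using J(1) laplace by (intro mult_left_mono prod_mono_ennreal) auto
  also have "\<dots> = ennreal (exp (\<theta> * L) * \<psi> ^ length (path_edges p))"
    using psi J by (simp add: ennreal_mult ennreal_power)
  finally show ?thesis
    using psi by (simp add: emeasure_eq_measure)
qed

text \<open>Union bound over paths, grouped by length: at most \<open>n ^ (k - 1)\<close> paths have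
  \<open>k\<close> edges, each contributing \<open>(\<phi> / n) ^ k\<close>, which leaves
  \<open>\<phi> ^ k / n\<close>.\<close>

lemma (in prob_space) prob_light_path_le:
  fixes X :: "nat set \<Rightarrow> 'a \<Rightarrow> real"
  assumes indep: "indep_vars (\<lambda>_. borel) X (complete_edges n)"
    and n: "n \<ge> 1" and theta: "\<theta> \<ge> 0" and phi: "\<phi> \<ge> 0"
    and laplace: "\<And>e. e \<in> complete_edges n \<Longrightarrow>
      (\<integral>\<^sup>+\<omega>. ennreal (exp (- \<theta> * X e \<omega>)) \<partial>M) \<le> ennreal (\<phi> / n)"
  shows "prob {\<omega> \<in> space M. \<exists>p\<in>self_avoiding_paths n 1 2.
            length (path_edges p) \<in> I \<and> path_weight (\<lambda>e. X e \<omega>) p \<le> L}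
    \<le> exp (\<theta> * L) / n * (\<Sum>k\<in>I \<inter> {1..n}. \<phi> ^ k)"
proof -
  define S where "S = {p \<in> self_avoiding_paths n 1 2. length (path_edges p) \<in> I}"
  have S: "finite S" by (simp add: S_def)
  have X: "random_variable borel (X e)" if "e \<in> complete_edges n" for e
    using indep that by (auto simp: indep_vars_def)
  have ev: "{\<omega> \<in> space M. path_weight (\<lambda>e. X e \<omega>) p \<le> L} \<in> sets M" if "p \<in> S" for p
  proof -
    have "(\<lambda>\<omega>. path_weight (\<lambda>e. X e \<omega>) p) \<in> borel_measurable M"
      using that by (intro borel_measurable_path_weight[OF X]) (auto simp: S_def)
    then show ?thesis by measurable
  qed
  have "prob {\<omega> \<in> space M. \<exists>p\<in>self_avoiding_paths n 1 2.
            length (path_edges p) \<in> I \<and> path_weight (\<lambda>e. X e \<omega>) p \<le> L}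
      = prob (\<Union>p\<in>S. {\<omega> \<in> space M. path_weight (\<lambda>e. X e \<omega>) p \<le> L})"
    by (rule arg_cong[of _ _ prob]) (auto simp: S_def)
  also have "\<dots> \<le> (\<Sum>p\<in>S. prob {\<omega> \<in> space M. path_weight (\<lambda>e. X e \<omega>) p \<le> L})"
    using S ev by (intro finite_measure_subadditive_finite) auto
  also have "\<dots> \<le> (\<Sum>p\<in>S. exp (\<theta> * L) * (\<phi> / n) ^ length (path_edges p))"
    using phi by (intro sum_mono prob_path_weight_le[OF indep theta _ laplace]) (auto simp: S_def)
  also have "\<dots> = (\<Sum>k\<in>I \<inter> {1..n}. \<Sum>p\<in>{p \<in> S. length (path_edges p) = k}.
      exp (\<theta> * L) * (\<phi> / n) ^ length (path_edges p))"
    using S length_path_edges_bounds by (intro sum.group[symmetric]) (auto simp: S_def)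
  also have "\<dots> \<le> (\<Sum>k\<in>I \<inter> {1..n}. exp (\<theta> * L) / n * \<phi> ^ k)"
  proof (rule sum_mono)
    fix k assume k: "k \<in> I \<inter> {1..n}"
    have "{p \<in> S. length (path_edges p) = k}
        = {p \<in> self_avoiding_paths n 1 2. length (path_edges p) = k}"
      using k by (auto simp: S_def)
    then have c: "real (card {p \<in> S. length (path_edges p) = k}) \<le> real (n ^ (k - 1))"
      using card_self_avoiding_paths_length[of k n] k by (simp del: of_nat_power)
    have "(\<Sum>p\<in>{p \<in> S. length (path_edges p) = k}. exp (\<theta> * L) * (\<phi> / n) ^ length (path_edges p))
        = real (card {p \<in> S. length (path_edges p) = k}) * (exp (\<theta> * L) * (\<phi> / n) ^ k)"
      by simp
    also have "\<dots> \<le> real (n ^ (k - 1)) * (exp (\<theta> * L) * (\<phi> / n) ^ k)"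
      using phi by (intro mult_right_mono c) auto
    also have "\<dots> = exp (\<theta> * L) / n * \<phi> ^ k"
    proof -
      have "real n ^ k = real n * real n ^ (k - 1)"
        using k by (cases k) auto
      then show ?thesis using n by (simp add: power_divide)
    qed
    finally show "(\<Sum>p\<in>{p \<in> S. length (path_edges p) = k}.
      exp (\<theta> * L) * (\<phi> / n) ^ length (path_edges p)) \<le> exp (\<theta> * L) / n * \<phi> ^ k" .
  qed
  finally show ?thesis by (simp add: sum_distrib_left)
qed

text \<open>Let \<open>Z\<close> count the \<open>q\<close> all of whose edges have weight at most
  \<open>c\<close>. The event says \<open>Z = 0\<close>, so \<open>Z\<close> deviates from its mean
  by the whole mean, and Chebyshev's inequality bounds the probability by the variance over the
  squared mean.\<close>

lemma (in prob_space) second_moment_edge_sets: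
  fixes X :: "'e \<Rightarrow> 'a \<Rightarrow> real" and S :: "'q \<Rightarrow> 'e set"
  assumes indep: "indep_vars (\<lambda>_. borel) X K"
    and p: "\<And>e. e \<in> K \<Longrightarrow> prob {\<omega> \<in> space M. X e \<omega> \<le> c} = p" and p0: "p > 0"
    and Q: "finite Q" "Q \<noteq> {}" and S: "\<And>q. q \<in> Q \<Longrightarrow> finite (S q) \<and> S q \<subseteq> K"
  shows "prob {\<omega> \<in> space M. \<forall>q\<in>Q. \<exists>e\<in>S q. X e \<omega> > c}
    \<le> (\<Sum>q\<in>Q. \<Sum>r\<in>Q. p ^ card (S q \<union> S r)) / (\<Sum>q\<in>Q. p ^ card (S q))\<^sup>2 - 1"
proof -
  define I where "I e \<omega> = (indicator {..c} (X e \<omega>) :: real)" for e \<omega>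
  define Z where "Z \<omega> = (\<Sum>q\<in>Q. \<Prod>e\<in>S q. I e \<omega>)" for \<omega>
  have X: "random_variable borel (X e)" if "e \<in> K" for e
    using indep that by (auto simp: indep_vars_def)
  have I: "integrable M (I e)" "expectation (I e) = p" if "e \<in> K" for e
  proof -
    have *: "I e \<omega> = indicator {\<omega> \<in> space M. X e \<omega> \<le> c} \<omega>" if "\<omega> \<in> space M" for \<omega>
      using that by (simp add: I_def indicator_def)
    have ev: "{\<omega> \<in> space M. X e \<omega> \<le> c} \<in> sets M" using X[OF that] by measurable
    show "integrable M (I e)"
      by (subst Bochner_Integration.integrable_cong[OF refl *])
        (use ev in \<open>auto intro!: integrable_real_indicator simp: emeasure_eq_measure\<close>)
    show "expectation (I e) = p"
      using p[OF that] ev by (subst Bochner_Integration.integral_cong[OF refl *]) auto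
  qed
  have prodI: "integrable M (\<lambda>\<omega>. \<Prod>e\<in>T. I e \<omega>)" "expectation (\<lambda>\<omega>. \<Prod>e\<in>T. I e \<omega>) = p ^ card T"
    if "finite T" "T \<subseteq> K" for T
  proof -
    have ind: "indep_vars (\<lambda>_. borel) I T"
      unfolding I_def[abs_def]
      by (rule indep_vars_compose2[OF indep_vars_subset[OF indep that(2)]]) simp
    show "integrable M (\<lambda>\<omega>. \<Prod>e\<in>T. I e \<omega>)"
      using that by (intro indep_vars_integrable ind I) auto
    show "expectation (\<lambda>\<omega>. \<Prod>e\<in>T. I e \<omega>) = p ^ card T"
      using that I by (subst indep_vars_lebesgue_integral[OF _ ind]) (auto simp: subset_iff)
  qed
  have Zsq: "(Z \<omega>)\<^sup>2 = (\<Sum>q\<in>Q. \<Sum>r\<in>Q. \<Prod>e\<in>S q \<union> S r. I e \<omega>)" for \<omega>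
  proof -
    \<comment> \<open>Indicators are idempotent: a common edge counts once.\<close>
    have "(\<Prod>e\<in>S q. I e \<omega>) * (\<Prod>e\<in>S r. I e \<omega>) = (\<Prod>e\<in>S q \<union> S r. I e \<omega>)" if "q \<in> Q" "r \<in> Q" for q r
    proof -
      have 01: "(\<Prod>e\<in>T. I e \<omega>) = of_bool (\<forall>e\<in>T. X e \<omega> \<le> c)" if "finite T" for T
        using that by (induction T rule: finite_induct) (auto simp: I_def)
      show ?thesis using that S by (auto simp: 01)
    qed
    then show ?thesis
      unfolding Z_def power2_eq_square sum_product by (intro sum.cong) auto
  qed
  have EZ: "expectation Z = (\<Sum>q\<in>Q. p ^ card (S q))"
    unfolding Z_def[abs_def] using S by (subst Bochner_Integration.integral_sum) (auto simp: prodI)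
  have int2: "integrable M (\<lambda>\<omega>. (Z \<omega>)\<^sup>2)"
    unfolding Zsq using S by (intro Bochner_Integration.integrable_sum prodI) auto
  have EZ2: "expectation (\<lambda>\<omega>. (Z \<omega>)\<^sup>2) = (\<Sum>q\<in>Q. \<Sum>r\<in>Q. p ^ card (S q \<union> S r))"
    unfolding Zsq using S
    by (subst Bochner_Integration.integral_sum)
      (auto simp: prodI intro!: sum.cong Bochner_Integration.integrable_sum
        Bochner_Integration.integral_sum[THEN trans])
  have int1: "integrable M Z"
    unfolding Z_def[abs_def] using S by (intro Bochner_Integration.integrable_sum prodI) auto
  have pos: "expectation Z > 0"
    unfolding EZ using Q p0 by (intro sum_pos) auto
  have "prob {\<omega> \<in> space M. \<forall>q\<in>Q. \<exists>e\<in>S q. X e \<omega> > c}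
      \<le> prob {\<omega> \<in> space M. expectation Z \<le> \<bar>Z \<omega> - expectation Z\<bar>}"
  proof (rule finite_measure_mono)
    show "{\<omega> \<in> space M. \<forall>q\<in>Q. \<exists>e\<in>S q. X e \<omega> > c}
        \<subseteq> {\<omega> \<in> space M. expectation Z \<le> \<bar>Z \<omega> - expectation Z\<bar>}"
    proof safe
      fix \<omega> assume "\<forall>q\<in>Q. \<exists>e\<in>S q. X e \<omega> > c"
      then have "(\<Prod>e\<in>S q. I e \<omega>) = 0" if "q \<in> Q" for q
        using S[OF that] that by (intro prod_zero) (force simp: I_def)+
      then have "Z \<omega> = 0" by (simp add: Z_def)
      then show "expectation Z \<le> \<bar>Z \<omega> - expectation Z\<bar>" using pos by simp
    qed
    show "{\<omega> \<in> space M. expectation Z \<le> \<bar>Z \<omega> - expectation Z\<bar>} \<in> sets M"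
      using borel_measurable_integrable[OF int1] by measurable
  qed
  also have "\<dots> \<le> variance Z / (expectation Z)\<^sup>2"
    using pos int2 by (intro Chebyshev_inequality borel_measurable_integrable[OF int1])
  also have "\<dots> = expectation (\<lambda>\<omega>. (Z \<omega>)\<^sup>2) / (expectation Z)\<^sup>2 - 1"
    using pos by (simp add: variance_eq[OF int1 int2] diff_divide_distrib)
  finally show ?thesis by (simp add: EZ EZ2)
qed

section \<open>Layered paths\<close>

text \<open>
  The layers are consecutive blocks of \<open>m\<close> vertices starting at vertex 3; paths are grown backwards
  from vertex 2.
\<close>

primrec layered_paths :: "nat \<Rightarrow> nat \<Rightarrow> nat list set" where
  "layered_paths m 0 = {[2]}"
| "layered_paths m (Suc i) =
     (\<lambda>(v, q). v # q) ` ({3 + i * m..<3 + Suc i * m} \<times> layered_paths m i)"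

text \<open>Each new vertex comes from a block lying strictly above all vertices used so far, which
  gives distinctness.\<close>

lemma layered_pathsD:
  assumes "q \<in> layered_paths m i"
  shows "q \<noteq> [] \<and> last q = 2 \<and> length q = Suc i \<and> distinct q \<and> set q \<subseteq> {2..<3 + i * m}"
  using assms
proof (induction i arbitrary: q)
  case (Suc i)
  then obtain v r where v: "q = v # r" "v \<in> {3 + i * m..<3 + Suc i * m}" "r \<in> layered_paths m i"
    by auto
  from Suc.IH[OF v(3)] have r: "r \<noteq> []" "last r = 2" "length r = Suc i" "distinct r"
      "set r \<subseteq> {2..<3 + i * m}" by auto
  have "v \<notin> set r" using v(2) r(5) by auto
  moreover have "set q \<subseteq> {2..<3 + Suc i * m}"
    using v r(5) by (fastforce)
  ultimately show ?case using r v(1) by auto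
qed auto

lemma finite_layered_paths [simp]: "finite (layered_paths m i)"
  by (induction i) auto

lemma inj_on_Cons_pair: "inj_on (\<lambda>(v, q). v # q) A"
  by (auto simp: inj_on_def)

lemma card_layered_paths: "card (layered_paths m i) = m ^ i"
  by (induction i) (auto simp: card_image[OF inj_on_Cons_pair] card_cartesian_product)

lemma sum_layered_paths_Suc:
  "(\<Sum>q\<in>layered_paths m (Suc i). f q)
    = (\<Sum>v\<in>{3 + i * m..<3 + Suc i * m}. \<Sum>q\<in>layered_paths m i. f (v # q))"
  unfolding layered_paths.simps
  by (subst sum.reindex[OF inj_on_Cons_pair]) (simp add: sum.cartesian_product case_prod_unfold)

text \<open>The probability that all edges of both paths are light, when edges are light
  independently with probability \<open>p\<close>.\<close>

definition pair_weight :: "real \<Rightarrow> 'v list \<Rightarrow> 'v list \<Rightarrow> real" where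
  "pair_weight p q r = p ^ card (set (path_edges q) \<union> set (path_edges r))"

lemma pair_weight_nonneg: "p \<ge> 0 \<Longrightarrow> pair_weight p q r \<ge> 0"
  by (simp add: pair_weight_def)

text \<open>The new first vertices are fresh, so the new edges do not occur in the old paths; they
  coincide with each other only if both their endpoints agree. This costs one factor
  \<open>p\<close> in that case and two otherwise.\<close>

lemma pair_weight_Cons:
  assumes "q \<noteq> []" "r \<noteq> []" "v \<notin> set q \<union> set r" "w \<notin> set q \<union> set r"
  shows "pair_weight p (v # q) (w # r)
    = (if v = w \<and> hd q = hd r then p else p\<^sup>2) * pair_weight p q r"
proof -
  define U where "U = set (path_edges q) \<union> set (path_edges r)"
  have U: "finite U" by (simp add: U_def)
  have eq: "set (path_edges (v # q)) \<union> set (path_edges (w # r))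
      = insert {v, hd q} (insert {w, hd r} U)"
    using assms(1,2) by (cases q; cases r) (auto simp: U_def)
  have new: "{v, hd q} \<notin> U" "{w, hd r} \<notin> U"
    using assms(3,4) path_edges_subset by (fastforce simp: U_def)+
  have "hd q \<in> set q" "hd r \<in> set r" using assms by auto
  then have "{v, hd q} = {w, hd r} \<longleftrightarrow> v = w \<and> hd q = hd r"
    using assms by (auto simp: doubleton_eq_iff)
  then show ?thesis
    using new U unfolding pair_weight_def eq U_def[symmetric]
    by (auto simp: card_insert_if power2_eq_square)
qed

text \<open>
  The pair sum is split by whether the first vertices agree, since only then can two paths that
  are extended by the same vertex share the new edge.
\<close>

definition same_head_sum :: "real \<Rightarrow> nat \<Rightarrow> nat \<Rightarrow> real" where
  "same_head_sum p m i = (\<Sum>q\<in>layered_paths m i. \<Sum>r\<in>layered_paths m i.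
     if hd q = hd r then pair_weight p q r else 0)"

definition diff_head_sum :: "real \<Rightarrow> nat \<Rightarrow> nat \<Rightarrow> real" where
  "diff_head_sum p m i = (\<Sum>q\<in>layered_paths m i. \<Sum>r\<in>layered_paths m i.
     if hd q = hd r then 0 else pair_weight p q r)"

text \<open>Extension of both paths by a common vertex. It serves the step from layer to layer and
  also the final step to vertex 1.\<close>

lemma sum_pair_weight_Cons:
  assumes "\<And>q. q \<in> layered_paths m i \<Longrightarrow> v \<notin> set q"
  shows "(\<Sum>q\<in>layered_paths m i. \<Sum>r\<in>layered_paths m i. pair_weight p (v # q) (v # r))
    = p * same_head_sum p m i + p\<^sup>2 * diff_head_sum p m i"
  using assms layered_pathsD unfolding same_head_sum_def diff_head_sum_def sum_distrib_left
    sum.distrib[symmetric]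
  by (intro sum.cong) (auto simp: pair_weight_Cons)

lemma sum_pair_weight_Cons_neq:
  assumes "\<And>q. q \<in> layered_paths m i \<Longrightarrow> v \<notin> set q" "\<And>q. q \<in> layered_paths m i \<Longrightarrow> w \<notin> set q" "v \<noteq> w"
  shows "(\<Sum>q\<in>layered_paths m i. \<Sum>r\<in>layered_paths m i. pair_weight p (v # q) (w # r))
    = p\<^sup>2 * (same_head_sum p m i + diff_head_sum p m i)"
  using assms layered_pathsD unfolding same_head_sum_def diff_head_sum_def sum_distrib_left
    sum.distrib[symmetric]
  by (intro sum.cong) (auto simp: pair_weight_Cons)

lemma head_sum_nonneg:
  assumes "p \<ge> 0"
  shows "same_head_sum p m i \<ge> 0" "diff_head_sum p m i \<ge> 0"
  using assms unfolding same_head_sum_def diff_head_sum_def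
  by (auto intro!: sum_nonneg pair_weight_nonneg)

lemma layer_disjoint:
  "v \<in> {3 + i * m..<3 + Suc i * m} \<Longrightarrow> q \<in> layered_paths m i \<Longrightarrow> v \<notin> set q"
  using layered_pathsD[of q m i] by auto

lemma same_head_sum_Suc:
  "same_head_sum p m (Suc i) = m * (p * same_head_sum p m i + p\<^sup>2 * diff_head_sum p m i)"
proof -
  let ?V = "{3 + i * m..<3 + Suc i * m}" and ?L = "layered_paths m i"
  have "same_head_sum p m (Suc i) = (\<Sum>v\<in>?V. \<Sum>q\<in>?L. \<Sum>w\<in>?V. \<Sum>r\<in>?L.
      if v = w then pair_weight p (v # q) (w # r) else 0)"
    unfolding same_head_sum_def sum_layered_paths_Suc by simp
  also have "\<dots> = (\<Sum>v\<in>?V. \<Sum>q\<in>?L. \<Sum>r\<in>?L. pair_weight p (v # q) (v # r))"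
  proof (intro sum.cong refl)
    fix v q assume v: "v \<in> ?V"
    have "(\<Sum>w\<in>?V. \<Sum>r\<in>?L. if v = w then pair_weight p (v # q) (w # r) else 0)
        = (\<Sum>w\<in>?V. if v = w then (\<Sum>r\<in>?L. pair_weight p (v # q) (w # r)) else 0)"
      by (intro sum.cong) auto
    also have "\<dots> = (\<Sum>r\<in>?L. pair_weight p (v # q) (v # r))"
      using v by (simp only: sum.delta' finite_atLeastLessThan if_True)
    finally show "(\<Sum>w\<in>?V. \<Sum>r\<in>?L. if v = w then pair_weight p (v # q) (w # r) else 0)
        = (\<Sum>r\<in>?L. pair_weight p (v # q) (v # r))" .
  qed
  also have "\<dots> = (\<Sum>v\<in>?V. p * same_head_sum p m i + p\<^sup>2 * diff_head_sum p m i)"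
    using layer_disjoint by (intro sum.cong sum_pair_weight_Cons) blast+
  finally show ?thesis by simp
qed

text \<open>Distinct new vertices never share the new edge, whatever the old heads are. The number
  of ordered pairs of distinct vertices is estimated by \<open>m\<^sup>2\<close>.\<close>

lemma diff_head_sum_Suc_le:
  assumes "p \<ge> 0"
  shows "diff_head_sum p m (Suc i) \<le> (m * p)\<^sup>2 * (same_head_sum p m i + diff_head_sum p m i)"
proof -
  let ?V = "{3 + i * m..<3 + Suc i * m}" and ?L = "layered_paths m i"
  have "diff_head_sum p m (Suc i) = (\<Sum>v\<in>?V. \<Sum>q\<in>?L. \<Sum>w\<in>?V. \<Sum>r\<in>?L.
      if v = w then 0 else pair_weight p (v # q) (w # r))"
    unfolding diff_head_sum_def sum_layered_paths_Suc by simp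
  also have "\<dots> = (\<Sum>v\<in>?V. \<Sum>w\<in>?V. \<Sum>q\<in>?L. \<Sum>r\<in>?L.
      if v = w then 0 else pair_weight p (v # q) (w # r))"
    by (intro sum.cong refl sum.swap)
  also have "\<dots> \<le> (\<Sum>v\<in>?V. \<Sum>w\<in>?V. p\<^sup>2 * (same_head_sum p m i + diff_head_sum p m i))"
  proof (intro sum_mono)
    fix v w assume "v \<in> ?V" "w \<in> ?V"
    then show "(\<Sum>q\<in>?L. \<Sum>r\<in>?L. if v = w then 0 else pair_weight p (v # q) (w # r))
        \<le> p\<^sup>2 * (same_head_sum p m i + diff_head_sum p m i)"
      using head_sum_nonneg[OF assms, of m i] layer_disjoint[of _ i m]
        sum_pair_weight_Cons_neq[of m i v w p]
      by (cases "v = w") auto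
  qed
  also have "\<dots> = (m * p)\<^sup>2 * (same_head_sum p m i + diff_head_sum p m i)"
    by (simp add: power2_eq_square)
  finally show ?thesis .
qed

text \<open>After division by \<open>\<mu> ^ (2 * i)\<close>, the squared mean number of light
  layered paths, the two sums are at most \<alpha> and \<beta> with the recursion \<alpha>' =
  \<alpha> / \<mu> + \<beta> / m and \<beta>' = \<alpha> + \<beta>. The term
  \<open>(1 / \<mu>) ^ i\<close> stems from pairs that agree from vertex 2 onwards, the term
  \<open>4 / m\<close> from paths that separate and meet again.\<close>

lemma head_sum_le:
  fixes p :: real and m k :: nat
  defines "\<mu> \<equiv> m * p"
  assumes p: "0 < p" "p \<le> 1" and mu: "\<mu> \<ge> 4" and k: "8 * k \<le> m" and i: "i \<le> k"
  shows "same_head_sum p m i \<le> \<mu> ^ (2 * i) * ((1 / \<mu>) ^ i + 4 / m)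
    \<and> diff_head_sum p m i \<le> \<mu> ^ (2 * i) * ((\<Sum>j<i. (1 / \<mu>) ^ j) + 4 * i / m)"
  using i
proof (induction i)
  case 0
  then show ?case by (simp add: same_head_sum_def diff_head_sum_def pair_weight_def)
next
  case (Suc i)
  define D where "D = same_head_sum p m i"
  define O' where "O' = diff_head_sum p m i"
  define \<beta> where "\<beta> = (\<Sum>j<i. (1 / \<mu>) ^ j) + 4 * i / m"
  define \<alpha> where "\<alpha> = (1 / \<mu>) ^ i + 4 / m"
  have m: "m > 0" using mu by (cases m) (auto simp: \<mu>_def)
  have IH: "D \<le> \<mu> ^ (2 * i) * \<alpha>" "O' \<le> \<mu> ^ (2 * i) * \<beta>"
    using Suc by (auto simp: D_def O'_def \<alpha>_def \<beta>_def)
  have "(\<Sum>j<i. (1 / \<mu>) ^ j) = (1 - (1 / \<mu>) ^ i) / (1 - 1 / \<mu>)"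
    using mu by (subst sum_gp_strict) auto
  also have "\<dots> \<le> 1 / (1 - 1 / \<mu>)"
    using mu by (intro divide_right_mono) auto
  also have "\<dots> \<le> 3 / 2" using mu by (simp add: field_simps)
  finally have b1: "(\<Sum>j<i. (1 / \<mu>) ^ j) \<le> 3 / 2" .
  have "8 * real i \<le> m" using k Suc.prems by (metis Suc_leD of_nat_le_iff of_nat_mult of_nat_numeral order_trans mult_le_mono2)
  then have "4 * real i / m \<le> 1 / 2" using m by (simp add: field_simps)
  \<comment> \<open>The assumptions \<open>\<mu> \<ge> 4\<close> and \<open>8 * k \<le> m\<close>
    serve to keep \<beta> below 2; then \<open>4 / m\<close> reproduces itself in the recursion, as
    \<open>1 / m + 2 / m \<le> 4 / m\<close>.\<close>
  with b1 have b: "\<beta> \<le> 2" by (simp add: \<beta>_def)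
  have pm: "p = \<mu> / m" using m by (simp add: \<mu>_def)
  have S: "\<mu> ^ (2 * Suc i) = \<mu>\<^sup>2 * \<mu> ^ (2 * i)" by (simp add: power2_eq_square)
  have "same_head_sum p m (Suc i) = \<mu> * D + \<mu>\<^sup>2 / m * O'"
    using m by (simp add: same_head_sum_Suc D_def O'_def \<mu>_def field_simps power2_eq_square)
  also have "\<dots> \<le> \<mu> * (\<mu> ^ (2 * i) * \<alpha>) + \<mu>\<^sup>2 / m * (\<mu> ^ (2 * i) * \<beta>)"
    using IH mu by (intro add_mono mult_left_mono) auto
  also have "\<dots> = \<mu> ^ (2 * Suc i) * (\<alpha> / \<mu> + \<beta> / m)"
    using mu m by (simp add: S field_simps power2_eq_square)
  also have "\<dots> \<le> \<mu> ^ (2 * Suc i) * ((1 / \<mu>) ^ Suc i + 4 / m)"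
  proof (intro mult_left_mono)
    have "4 / m / \<mu> \<le> 1 / m" using mu m by (simp add: field_simps)
    moreover have "\<beta> / m \<le> 2 / m" using b m by (simp add: divide_right_mono)
    moreover have "1 / real m + 2 / m \<le> 4 / m" using m by (simp add: field_simps)
    ultimately show "\<alpha> / \<mu> + \<beta> / m \<le> (1 / \<mu>) ^ Suc i + 4 / m"
      by (simp add: \<alpha>_def add_divide_distrib)
  qed (use mu in auto)
  finally have 1: "same_head_sum p m (Suc i) \<le> \<mu> ^ (2 * Suc i) * ((1 / \<mu>) ^ Suc i + 4 / m)" .
  have "diff_head_sum p m (Suc i) \<le> \<mu>\<^sup>2 * (D + O')"
    using diff_head_sum_Suc_le[of p m i] p by (simp add: D_def O'_def \<mu>_def)
  also have "\<dots> \<le> \<mu>\<^sup>2 * (\<mu> ^ (2 * i) * \<alpha> + \<mu> ^ (2 * i) * \<beta>)"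
    using IH by (intro mult_left_mono add_mono) auto
  also have "\<dots> = \<mu> ^ (2 * Suc i) * (\<alpha> + \<beta>)" by (simp only: S) (simp add: algebra_simps)
  also have "\<alpha> + \<beta> = (\<Sum>j<Suc i. (1 / \<mu>) ^ j) + 4 * real (Suc i) / m"
    by (simp add: \<alpha>_def \<beta>_def add_divide_distrib algebra_simps)
  finally show ?case using 1 by blast
qed

text \<open>Second moment method for the layered paths completed by vertex 1, whose mean number of
  light ones is \<open>p * \<mu> ^ k = \<mu> ^ Suc k / m\<close>. The first error term is the
  inverse of this mean; the second comes from edges shared near vertex 1 or vertex 2, the third from
  meetings in the layers between. The condition \<open>2 + k * m \<le> n\<close> makes the
  \<open>k\<close> layers fit.\<close>

lemma (in prob_space) prob_no_light_layered_path:
  fixes X :: "nat set \<Rightarrow> 'a \<Rightarrow> real" and m k n :: nat and p c :: real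
  assumes indep: "indep_vars (\<lambda>_. borel) X (complete_edges n)"
    and p: "\<And>e. e \<in> complete_edges n \<Longrightarrow> prob {\<omega> \<in> space M. X e \<omega> \<le> c} = p"
    and p0: "0 < p" and mu: "m * p \<ge> 4" and k: "8 * k \<le> m" and kn: "2 + k * m \<le> n"
  shows "prob {\<omega> \<in> space M. \<forall>q\<in>self_avoiding_paths n 1 2.
      length (path_edges q) = Suc k \<longrightarrow> (\<exists>e\<in>set (path_edges q). X e \<omega> > c)}
    \<le> m / (m * p) ^ Suc k + 6 / (m * p) + 4 * k / m"
proof -
  define \<mu> where "\<mu> = m * p"
  define Q where "Q = layered_paths m k"
  define S where "S q = set (path_edges (1 # q))" for q :: "nat list"
  have m: "m > 0" using mu by (cases m) auto
  have n: "n \<ge> 2" using kn by simp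
  have Q: "1 # q \<in> self_avoiding_paths n 1 2" "length (path_edges (1 # q)) = Suc k"
    "card (S q) = Suc k" "S q \<subseteq> complete_edges n" "1 \<notin> set q" "q \<noteq> []"
    if "q \<in> Q" for q
  proof -
    have q: "q \<noteq> []" "last q = 2" "length q = Suc k" "distinct q" "set q \<subseteq> {2..<3 + k * m}"
      using layered_pathsD that by (auto simp: Q_def)
    have "set q \<subseteq> {1..n}" using q(5) kn by force
    then show *: "1 # q \<in> self_avoiding_paths n 1 2"
      using q n by (intro self_avoiding_paths_I) auto
    show "length (path_edges (1 # q)) = Suc k" using q by (simp add: length_path_edges)
    then show "card (S q) = Suc k" using *
      by (simp add: S_def distinct_card distinct_path_edges self_avoiding_paths_def)
    show "S q \<subseteq> complete_edges n" using * by (simp add: S_def self_avoiding_paths_def)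
    show "1 \<notin> set q" using q(5) by auto
    show "q \<noteq> []" by fact
  qed
  \<comment> \<open>An existing edge is required to read \<open>p\<close> as a probability.\<close>
  have "{1, 2} \<in> complete_edges n" using n by (auto simp: complete_edges_def)
  from p[OF this] have p1: "p \<le> 1" by (metis prob_le_1)
  have cardQ: "card Q = m ^ k" by (simp add: Q_def card_layered_paths)
  then have Qne: "Q \<noteq> {}" using m by (metis card.empty neq0_conv power_eq_0_iff)
  have mu4: "\<mu> \<ge> 4" using mu by (simp add: \<mu>_def)
  have sum1: "(\<Sum>q\<in>Q. p ^ card (S q)) = p * \<mu> ^ k"
    using Q by (simp add: cardQ \<mu>_def power_mult_distrib)
  have sum2: "(\<Sum>q\<in>Q. \<Sum>r\<in>Q. p ^ card (S q \<union> S r)) = p * same_head_sum p m k + p\<^sup>2 * diff_head_sum p m k"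
    using sum_pair_weight_Cons[of m k 1 p] Q(5) by (simp add: Q_def S_def pair_weight_def)
  have bounds: "same_head_sum p m k \<le> \<mu> ^ (2 * k) * ((1 / \<mu>) ^ k + 4 / m)"
    "diff_head_sum p m k \<le> \<mu> ^ (2 * k) * ((\<Sum>j<k. (1 / \<mu>) ^ j) + 4 * k / m)"
    using head_sum_le[of p m k k] p0 p1 mu k by (auto simp: \<mu>_def)
  have "(\<Sum>j<k. (1 / \<mu>) ^ j) = (1 - (1 / \<mu>) ^ k) / (1 - 1 / \<mu>)"
    using mu4 by (subst sum_gp_strict) auto
  also have "\<dots> \<le> 1 / (1 - 1 / \<mu>)"
    using mu4 by (intro divide_right_mono) auto
  also have "\<dots> \<le> 1 + 2 / \<mu>" using mu4 by (simp add: field_simps power2_eq_square)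
  finally have gs: "(\<Sum>j<k. (1 / \<mu>) ^ j) \<le> 1 + 2 / \<mu>" .
  have "prob {\<omega> \<in> space M. \<forall>q\<in>self_avoiding_paths n 1 2.
      length (path_edges q) = Suc k \<longrightarrow> (\<exists>e\<in>set (path_edges q). X e \<omega> > c)}
      \<le> prob {\<omega> \<in> space M. \<forall>q\<in>Q. \<exists>e\<in>S q. X e \<omega> > c}"
  proof (rule finite_measure_mono)
    show "{\<omega> \<in> space M. \<forall>q\<in>Q. \<exists>e\<in>S q. X e \<omega> > c} \<in> sets M"
    proof (intro sets.sets_Collect_finite_All sets.sets_Collect_finite_Ex)
      fix q e assume "q \<in> Q" "e \<in> S q"
      then have "X e \<in> borel_measurable M" using indep Q(4) by (auto simp: indep_vars_def)
      then show "{\<omega> \<in> space M. X e \<omega> > c} \<in> sets M" by measurable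
    qed (auto simp: Q_def S_def)
  qed (use Q in \<open>auto simp: S_def\<close>)
  also have "\<dots> \<le> (\<Sum>q\<in>Q. \<Sum>r\<in>Q. p ^ card (S q \<union> S r)) / (\<Sum>q\<in>Q. p ^ card (S q))\<^sup>2 - 1"
    using Q(4) Qne by (intro second_moment_edge_sets[OF indep p p0]) (auto simp: Q_def S_def)
  also have "\<dots> = (p * same_head_sum p m k + p\<^sup>2 * diff_head_sum p m k) / (p\<^sup>2 * \<mu> ^ (2 * k)) - 1"
    by (simp add: sum1 sum2 power_mult_distrib power_mult[symmetric] mult.commute)
  also have "\<dots> \<le> (p * (\<mu> ^ (2 * k) * ((1 / \<mu>) ^ k + 4 / m))
      + p\<^sup>2 * (\<mu> ^ (2 * k) * (1 + 2 / \<mu> + 4 * k / m))) / (p\<^sup>2 * \<mu> ^ (2 * k)) - 1"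
    using p0 mu4 gs bounds
    by (intro diff_right_mono divide_right_mono add_mono mult_left_mono order.trans[OF bounds(2)]) auto
  also have "\<dots> = ((1 / \<mu>) ^ k + 4 / m) / p + (1 + 2 / \<mu> + 4 * k / m) - 1"
  proof -
    have "(p * (M * x) + p\<^sup>2 * (M * y)) / (p\<^sup>2 * M) = x / p + y" if "M > 0" for M x y :: real
      using that p0 by (simp add: field_simps power2_eq_square)
    then show ?thesis using mu4 by simp
  qed
  also have "\<dots> = m / \<mu> ^ Suc k + 6 / \<mu> + 4 * k / m"
    using p0 m by (simp add: \<mu>_def field_simps)
  finally show ?thesis by (simp add: \<mu>_def)
qed

section \<open>The edge weight distribution\<close>

lemma exponential_AE_nonneg:
  assumes "distributed N lborel E (exponential_density 1)"
  shows "AE \<omega> in N. 0 \<le> E \<omega>"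
proof -
  have "AE x in distr N lborel E. 0 \<le> x"
    unfolding distributed_distr_eq_density[OF assms]
    by (subst AE_density) (auto simp: exponential_density_def)
  then show ?thesis
    using distributed_measurable[OF assms] by (subst (asm) AE_distr_iff) auto
qed

text \<open>A single point has probability zero, so the closed tail equals the open one.\<close>

lemma (in prob_space) exponential_prob_ge:
  assumes D: "distributed M lborel E (exponential_density 1)" and x: "0 \<le> x"
  shows "prob {\<omega> \<in> space M. x \<le> E \<omega>} = exp (- x)"
proof -
  have E [measurable]: "E \<in> borel_measurable M" using distributed_measurable[OF D] by simp
  have "emeasure M {\<omega> \<in> space M. E \<omega> = x} = emeasure M (E -` {x} \<inter> space M)"
    by (rule arg_cong[of _ _ "emeasure M"]) auto
  also have "\<dots> = (\<integral>\<^sup>+y. ennreal (exponential_density 1 y) * indicator {x} y \<partial>lborel)"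
    by (rule distributed_emeasure[OF D]) simp
  also have "\<dots> = 0"
    by (subst nn_integral_0_iff_AE) (auto intro: AE_mp[OF AE_lborel_singleton[of x]])
  finally have "AE \<omega> in M. E \<omega> \<noteq> x"
    by (intro AE_I[of _ _ "{\<omega> \<in> space M. E \<omega> = x}"]) auto
  then have "prob {\<omega> \<in> space M. x \<le> E \<omega>} = prob {\<omega> \<in> space M. x < E \<omega>}"
    by (intro finite_measure_eq_AE) auto
  then show ?thesis using exponential_distributedD_gt[OF D x] by simp
qed

text \<open>The integral is split at \<open>x0\<close>. Below, density times \<open>f\<close> is at
  most the constant \<open>exp (- x0)\<close> on an interval of length \<open>x0\<close>; above,
  \<open>f\<close> is at most 1 and the tail has mass \<open>exp (- x0)\<close>.\<close>

lemma (in prob_space) exponential_nn_integral_le: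
  assumes D: "distributed M lborel E (exponential_density 1)" and x: "0 \<le> x0"
    and f: "f \<in> borel_measurable borel" "\<And>x. 0 \<le> x \<Longrightarrow> f x \<le> 1"
      "\<And>x. 0 \<le> x \<Longrightarrow> f x \<le> exp (x - x0)"
  shows "(\<integral>\<^sup>+\<omega>. ennreal (f (E \<omega>)) \<partial>M) \<le> ennreal ((x0 + 1) * exp (- x0))"
proof -
  let ?d = "exponential_density 1 :: real \<Rightarrow> real"
  have E [measurable]: "E \<in> borel_measurable M" using distributed_measurable[OF D] by simp
  have "(\<integral>\<^sup>+\<omega>. ennreal (f (E \<omega>)) \<partial>M) = (\<integral>\<^sup>+x. ennreal (?d x) * ennreal (f x) \<partial>lborel)"
    using f(1) by (subst distributed_nn_integral[OF D]) auto
  also have "\<dots> \<le> (\<integral>\<^sup>+x. ennreal (exp (- x0)) * indicator {0..x0} x + ennreal (?d x) * indicator {x0<..} x \<partial>lborel)"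
  proof (rule nn_integral_mono)
    fix x :: real
    consider "x < 0" | "0 \<le> x" "x \<le> x0" | "x0 < x" by linarith
    then show "ennreal (?d x) * ennreal (f x)
        \<le> ennreal (exp (- x0)) * indicator {0..x0} x + ennreal (?d x) * indicator {x0<..} x"
    proof cases
      case 1 then show ?thesis by (simp add: exponential_density_def)
    next
      case 2
      have "exp (- x) * f x \<le> exp (- x) * exp (x - x0)"
        using f(3) 2 by (intro mult_left_mono) auto
      also have "\<dots> = exp (- x0)" by (simp add: exp_add[symmetric])
      finally show ?thesis
        using 2 by (simp add: exponential_density_def ennreal_mult'[symmetric] ennreal_leI)
    next
      case 3
      then have "ennreal (?d x) * ennreal (f x) \<le> ennreal (?d x) * 1"
        using f(2)[of x] x by (intro mult_left_mono) auto
      then show ?thesis using 3 x by simp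
    qed
  qed
  also have "\<dots> = ennreal (exp (- x0)) * ennreal x0
      + (\<integral>\<^sup>+x. ennreal (?d x) * indicator {x0<..} x \<partial>lborel)"
    using x by (subst nn_integral_add) (auto simp: nn_integral_cmult_indicator)
  also have "(\<integral>\<^sup>+x. ennreal (?d x) * indicator {x0<..} x \<partial>lborel) = emeasure M (E -` {x0<..} \<inter> space M)"
    by (rule distributed_emeasure[OF D, symmetric]) simp
  also have "E -` {x0<..} \<inter> space M = {\<omega> \<in> space M. x0 < E \<omega>}" by auto
  also have "emeasure M {\<omega> \<in> space M. x0 < E \<omega>} = ennreal (exp (- x0))"
    using exponential_distributedD_gt[OF D x] by (simp add: emeasure_eq_measure)
  also have "ennreal (exp (- x0)) * ennreal x0 + ennreal (exp (- x0)) = ennreal ((x0 + 1) * exp (- x0))"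
    using x by (simp add: ennreal_mult'[symmetric] ennreal_plus[symmetric] algebra_simps del: ennreal_plus)
  finally show ?thesis .
qed

section \<open>The distribution function of the edge weights\<close>

lemma powr_transform_le_iff:
  fixes \<rho> \<alpha> v x :: real
  assumes "\<rho> > 0" "\<alpha> > 0" "0 < v" "v < 1" "x \<ge> 0"
  shows "exp (- ((x / \<rho>) powr (1 / \<alpha>))) \<le> v \<longleftrightarrow> \<rho> * (- ln v) powr \<alpha> \<le> x"
proof -
  have z: "- ln v > 0" using assms by simp
  have "exp (- ((x / \<rho>) powr (1 / \<alpha>))) \<le> v \<longleftrightarrow> - ln v \<le> (x / \<rho>) powr (1 / \<alpha>)"
    using assms by (subst ln_ge_iff[symmetric]) (auto simp: algebra_simps)
  also have "\<dots> \<longleftrightarrow> ((- ln v) powr \<alpha>) powr (1 / \<alpha>) \<le> (x / \<rho>) powr (1 / \<alpha>)"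
    using z assms by (simp add: powr_powr)
  also have "\<dots> \<longleftrightarrow> (- ln v) powr \<alpha> \<le> x / \<rho>"
  proof
    show "((- ln v) powr \<alpha>) powr (1 / \<alpha>) \<le> (x / \<rho>) powr (1 / \<alpha>) \<Longrightarrow> (- ln v) powr \<alpha> \<le> x / \<rho>"
      using assms by (metis not_le powr_less_mono2 powr_ge_zero divide_nonneg_pos zero_less_divide_1_iff less_eq_real_def)
    show "(- ln v) powr \<alpha> \<le> x / \<rho> \<Longrightarrow> ((- ln v) powr \<alpha>) powr (1 / \<alpha>) \<le> (x / \<rho>) powr (1 / \<alpha>)"
      using assms by (intro powr_mono2) auto
  qed
  also have "\<dots> \<longleftrightarrow> \<rho> * (- ln v) powr \<alpha> \<le> x"
    using assms by (simp add: field_simps)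
  finally show ?thesis .
qed

lemma (in prob_space) cdf_exp_powr:
  assumes rho: "\<rho> > 0" and alpha: "\<alpha> > 0" and D: "distributed M lborel E (exponential_density 1)"
    and v: "v > 0"
  defines "F \<equiv> cdf (distr M borel (\<lambda>\<omega>. exp (- ((E \<omega> / \<rho>) powr (1 / \<alpha>)))))"
  shows "F v = (if v < 1 then exp (- (\<rho> * (- ln v) powr \<alpha>)) else 1)"
proof -
  have E [measurable]: "E \<in> borel_measurable M" using distributed_measurable[OF D] by simp
  have "F v = prob ((\<lambda>\<omega>. exp (- ((E \<omega> / \<rho>) powr (1 / \<alpha>)))) -` {..v} \<inter> space M)"
    unfolding F_def cdf_def by (subst measure_distr) auto
  also have "\<dots> = prob {\<omega> \<in> space M. exp (- ((E \<omega> / \<rho>) powr (1 / \<alpha>))) \<le> v}"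
    by (rule arg_cong[of _ _ prob]) auto
  also have "\<dots> = (if v < 1 then exp (- (\<rho> * (- ln v) powr \<alpha>)) else 1)"
  proof (cases "v < 1")
    case True
    have "prob {\<omega> \<in> space M. exp (- ((E \<omega> / \<rho>) powr (1 / \<alpha>))) \<le> v}
        = prob {\<omega> \<in> space M. \<rho> * (- ln v) powr \<alpha> \<le> E \<omega>}"
      using exponential_AE_nonneg[OF D] True assms
      by (intro finite_measure_eq_AE) (auto elim!: eventually_mono simp: powr_transform_le_iff)
    also have "\<dots> = exp (- (\<rho> * (- ln v) powr \<alpha>))"
      using rho by (intro exponential_prob_ge[OF D]) auto
    finally show ?thesis using True by simp
  next
    case False
    \<comment> \<open>Values of \<open>powr\<close> are nonnegative, so a weight never exceeds
      1.\<close>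
    have "exp (- y) \<le> v" if "y \<ge> 0" for y :: real
      using False that by (smt (verit) one_le_exp_iff exp_le_one_iff)
    then have "{\<omega> \<in> space M. exp (- ((E \<omega> / \<rho>) powr (1 / \<alpha>))) \<le> v} = space M"
      by auto
    then show ?thesis using False prob_space by simp
  qed
  finally show ?thesis .
qed

section \<open>Convexity and the Laplace transform of the edge weights\<close>

lemma powr_ge_tangent:
  fixes r \<alpha> :: real
  assumes "r \<ge> 0" "\<alpha> \<ge> 1"
  shows "1 + \<alpha> * (r - 1) \<le> r powr \<alpha>"
proof (cases "r = 0")
  case False
  \<comment> \<open>Young's inequality with second entry 1 is the tangent inequality at 1.\<close>
  have "(r powr \<alpha>) powr (1 / \<alpha>) * 1 powr (1 - 1 / \<alpha>) \<le> 1 / \<alpha> * r powr \<alpha> + (1 - 1 / \<alpha>) * 1"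
    using assms False by (intro Youngs_inequality_0) auto
  then have "r \<le> 1 / \<alpha> * r powr \<alpha> + (1 - 1 / \<alpha>)"
    using assms False by (simp add: powr_powr)
  then have "\<alpha> * r \<le> \<alpha> * (1 / \<alpha> * r powr \<alpha> + (1 - 1 / \<alpha>))"
    using assms by (intro mult_left_mono) auto
  also have "\<dots> = r powr \<alpha> + \<alpha> - 1" using assms by (simp add: algebra_simps)
  finally show ?thesis by (simp add: algebra_simps)
qed (use assms in auto)

text \<open>With A = (l / \<rho>) powr (1 / \<alpha>), which is - ln u, the scale s equals A /
  (\<alpha> * l). In this form it is the slope needed for the tangent inequality.\<close>

lemma scale_eq:
  fixes \<rho> \<alpha> l :: real
  assumes "\<rho> > 0" "\<alpha> > 0" "l > 0"
  shows "1 / (\<alpha> * \<rho> powr (1 / \<alpha>)) * l powr (- 1 + 1 / \<alpha>) = (l / \<rho>) powr (1 / \<alpha>) / (\<alpha> * l)"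
proof -
  have "l powr (- 1 + 1 / \<alpha>) = l powr (1 / \<alpha>) / l"
    using assms by (simp only: powr_add powr_neg_one) simp
  then show ?thesis using assms by (simp add: powr_divide field_simps)
qed

text \<open>Convexity of \<open>y \<mapsto> y\<^sup>\<alpha>\<close> bounds the rescaled weight below by a power of a uniform variable.\<close>

lemma weight_power_lower_bound:
  fixes \<rho> \<alpha> l x :: real
  defines "s \<equiv> 1 / (\<alpha> * \<rho> powr (1 / \<alpha>)) * l powr (- 1 + 1 / \<alpha>)"
  assumes "\<rho> > 0" "\<alpha> \<ge> 1" "l > 0" "x \<ge> 0"
  shows "l - x \<le> ((l / \<rho>) powr (1 / \<alpha>) - (x / \<rho>) powr (1 / \<alpha>)) / s"
proof -
  define A where "A = (l / \<rho>) powr (1 / \<alpha>)"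
  define y where "y = (x / \<rho>) powr (1 / \<alpha>)"
  have A: "A > 0" "y \<ge> 0" using assms by (auto simp: A_def y_def)
  have s: "s = A / (\<alpha> * l)"
    using assms(2-4) by (simp only: s_def A_def scale_eq)
  have "1 + \<alpha> * (y / A - 1) \<le> (y / A) powr \<alpha>"
    using A assms by (intro powr_ge_tangent) auto
  also have "y / A = (x / l) powr (1 / \<alpha>)"
    using assms(2-5) by (simp add: A_def y_def powr_divide[symmetric])
  also have "((x / l) powr (1 / \<alpha>)) powr \<alpha> = x / l"
    using assms(2-5) by (simp add: powr_powr)
  finally have "1 + \<alpha> * ((x / l) powr (1 / \<alpha>) - 1) \<le> x / l" .
  moreover have "(x / l) powr (1 / \<alpha>) = y / A"
    using assms(2-5) by (simp add: A_def y_def powr_divide[symmetric])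
  ultimately have "l * (1 + \<alpha> * (y / A - 1)) \<le> l * (x / l)"
    using assms(4) by (intro mult_left_mono) auto
  moreover have "(A - y) / s = l * \<alpha> * (1 - y / A)"
    using A assms(3,4) by (simp add: s field_simps)
  ultimately show ?thesis
    using assms(4) unfolding A_def[symmetric] y_def[symmetric] by (simp add: algebra_simps)
qed

text \<open>Let y be the logarithm of the weight over \<open>u\<close>. Then the exponent is
  \<open>exp (\<eta> - 1 + y) / s\<close>, and \<open>1 + t \<le> exp t\<close> bounds it below by
  \<open>(\<eta> + y) / s\<close>; the shift by -1 in the parameter cancels the 1. By convexity
  \<open>y / s \<ge> l - x\<close>, so the integrand is at most \<open>exp (x - x0)\<close>.\<close>

lemma (in prob_space) laplace_weight_le:
  fixes \<rho> \<alpha> l \<eta> :: real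
  defines "s \<equiv> 1 / (\<alpha> * \<rho> powr (1 / \<alpha>)) * l powr (- 1 + 1 / \<alpha>)"
    and "u \<equiv> exp (- ((l / \<rho>) powr (1 / \<alpha>)))"
  defines "x0 \<equiv> l + \<eta> / s"
  assumes rho: "\<rho> > 0" and alpha: "\<alpha> \<ge> 1" and l: "l > 0" and x0: "x0 \<ge> 0"
    and D: "distributed M lborel E (exponential_density 1)"
  shows "(\<integral>\<^sup>+\<omega>. ennreal (exp (- (exp (\<eta> - 1) / (s * u)) * exp (- ((E \<omega> / \<rho>) powr (1 / \<alpha>))))) \<partial>M)
    \<le> ennreal ((x0 + 1) * exp (- x0))"
proof (rule exponential_nn_integral_le[OF D x0])
  have s: "s > 0" using rho alpha l by (simp add: s_def)
  fix x :: real assume x: "0 \<le> x"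
  show "exp (- (exp (\<eta> - 1) / (s * u)) * exp (- ((x / \<rho>) powr (1 / \<alpha>)))) \<le> 1"
    using s by (simp add: u_def)
  define y where "y = (l / \<rho>) powr (1 / \<alpha>) - (x / \<rho>) powr (1 / \<alpha>)"
  have "exp (\<eta> - 1) / (s * u) * exp (- ((x / \<rho>) powr (1 / \<alpha>))) = exp (\<eta> - 1 + y) / s"
    by (simp add: u_def y_def exp_add exp_diff exp_minus field_simps)
  moreover have "(\<eta> + y) / s \<le> exp (\<eta> - 1 + y) / s"
    using s exp_ge_add_one_self[of "\<eta> - 1 + y"] by (intro divide_right_mono) auto
  moreover have "l - x \<le> y / s"
    unfolding y_def s_def using rho alpha l x by (intro weight_power_lower_bound) auto
  ultimately show "exp (- (exp (\<eta> - 1) / (s * u)) * exp (- ((x / \<rho>) powr (1 / \<alpha>)))) \<le> exp (x - x0)"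
    by (simp add: x0_def add_divide_distrib)
qed simp

text \<open>With \<open>\<beta> = 1 / \<alpha>\<close> the first three limits are in the variable l
  = ln n: the scale tends to 0 fast enough to beat a logarithm of l, while its product with l
  diverges. The last is in n, where powers of ln n are negligible.\<close>

lemma scale_asymptotics:
  fixes C \<beta> :: real
  assumes "C > 0" "0 < \<beta>" "\<beta> < 1"
  shows "filterlim (\<lambda>l. C * l powr (- 1 + \<beta>) * l) at_top at_top"
    and "D > 0 \<Longrightarrow> ((\<lambda>l. C * l powr (- 1 + \<beta>) * ln (D * l + D')) \<longlongrightarrow> 0) at_top"
    and "((\<lambda>l. C * l powr (- 1 + \<beta>)) \<longlongrightarrow> 0) at_top"
    and "(\<lambda>n. (C * ln (real n) powr (- 1 + \<beta>) * ln (real n) + 1)\<^sup>2 / real n) \<longlonglongrightarrow> 0"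
  using assms by real_asymp+

section \<open>Asymptotics\<close>

text \<open>The closed form of \<open>u\<close> is demanded from n = 2 on only, so that the locale
  applies both to the closed form itself and to the critical value once the two are
  identified.\<close>

locale exp_power_weights =
  fixes \<rho> \<alpha> :: real and N :: "'b measure" and E :: "'b \<Rightarrow> real"
    and M :: "nat \<Rightarrow> 'a measure" and X :: "nat \<Rightarrow> nat set \<Rightarrow> 'a \<Rightarrow> real"
    and s u :: "nat \<Rightarrow> real"
  assumes rho: "\<rho> > 0" and alpha: "\<alpha> > 1"
    and prob_N: "prob_space N"
    and exp_E: "distributed N lborel E (exponential_density 1)"
    and prob_M: "\<And>n. prob_space (M n)"
    and indep: "\<And>n. prob_space.indep_vars (M n) (\<lambda>_. borel) (X n) (complete_edges n)"
    and law: "\<And>n e. e \<in> complete_edges n \<Longrightarrow>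
      distr (M n) borel (X n e) = distr N borel (\<lambda>\<omega>. exp (- ((E \<omega> / \<rho>) powr (1 / \<alpha>))))"
    and s_def: "\<And>n. s n = 1 / (\<alpha> * \<rho> powr (1 / \<alpha>)) * ln (real n) powr (- 1 + 1 / \<alpha>)"
    and u_eq: "\<And>n. n \<ge> 2 \<Longrightarrow> u n = exp (- ((ln (real n) / \<rho>) powr (1 / \<alpha>)))"
begin

abbreviation h :: "nat \<Rightarrow> real" where "h n \<equiv> s n * ln (real n)"

abbreviation light_event :: "nat \<Rightarrow> nat set \<Rightarrow> real \<Rightarrow> 'a set" where
  "light_event n I L \<equiv> {\<omega> \<in> space (M n). \<exists>p\<in>self_avoiding_paths n 1 2.
     length (path_edges p) \<in> I \<and> path_weight (\<lambda>e. X n e \<omega>) p \<le> L}"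

lemma rv: "e \<in> complete_edges n \<Longrightarrow> X n e \<in> borel_measurable (M n)"
  using indep[of n] unfolding prob_space.indep_vars_def[OF prob_M] by blast

lemma E_measurable [measurable]: "E \<in> borel_measurable N"
  using distributed_measurable[OF exp_E] by simp

lemma s_pos: "n \<ge> 2 \<Longrightarrow> s n > 0"
  using rho alpha by (simp add: s_def)

lemma u_pos: "n \<ge> 2 \<Longrightarrow> u n > 0"
  by (simp add: u_eq)

lemma sets_light_event: "light_event n I L \<in> sets (M n)"
proof (rule sets.sets_Collect_finite_Ex[OF _ finite_self_avoiding_paths])
  fix p assume "p \<in> self_avoiding_paths n 1 2"
  then have "(\<lambda>\<omega>. path_weight (\<lambda>e. X n e \<omega>) p) \<in> borel_measurable (M n)"
    using rv by (intro borel_measurable_path_weight) auto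
  then have "{\<omega> \<in> space (M n). path_weight (\<lambda>e. X n e \<omega>) p \<le> L} \<in> sets (M n)"
    by measurable
  then show "{\<omega> \<in> space (M n). length (path_edges p) \<in> I \<and> path_weight (\<lambda>e. X n e \<omega>) p \<le> L} \<in> sets (M n)"
    by (cases "length (path_edges p) \<in> I") simp_all
qed

lemma cdf_weight:
  assumes "e \<in> complete_edges n" "v > 0"
  shows "cdf (distr (M n) borel (X n e)) v = (if v < 1 then exp (- (\<rho> * (- ln v) powr \<alpha>)) else 1)"
  unfolding law[OF assms(1)] using alpha by (intro prob_space.cdf_exp_powr[OF prob_N rho _ exp_E assms(2)]) simp

lemma prob_weight_le:
  assumes "e \<in> complete_edges n" "0 < v" "v < 1"
  shows "measure (M n) {\<omega> \<in> space (M n). X n e \<omega> \<le> v} = exp (- (\<rho> * (- ln v) powr \<alpha>))"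
proof -
  have "measure (M n) {\<omega> \<in> space (M n). X n e \<omega> \<le> v} = cdf (distr (M n) borel (X n e)) v"
    unfolding cdf_def using rv[OF assms(1)]
    by (subst measure_distr) (auto intro!: arg_cong[of _ _ "measure (M n)"])
  then show ?thesis using cdf_weight[OF assms(1,2)] assms(3) by simp
qed

lemma critical_value:
  assumes "n \<ge> 2" "e \<in> complete_edges n"
  shows "0 < v \<and> real n * cdf (distr (M n) borel (X n e)) v = 1
    \<longleftrightarrow> v = exp (- ((ln (real n) / \<rho>) powr (1 / \<alpha>)))"
proof
  define l where "l = ln (real n)"
  have l: "l > 0" "real n = exp l" using assms by (auto simp: l_def)
  {
    assume v: "0 < v \<and> real n * cdf (distr (M n) borel (X n e)) v = 1"
    \<comment> \<open>At \<open>v \<ge> 1\<close> the distribution function is 1 and the product is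
      n, which is at least 2.\<close>
    then have v1: "v < 1" using cdf_weight[OF assms(2), of v] assms(1) by (cases "v < 1") auto
    with v have "exp (l + - (\<rho> * (- ln v) powr \<alpha>)) = exp 0"
      using cdf_weight[OF assms(2), of v] l by (simp only: exp_add) simp
    then have "(- ln v) powr \<alpha> = l / \<rho>" using rho by (simp add: field_simps)
    then have "(l / \<rho>) powr (1 / \<alpha>) = ((- ln v) powr \<alpha>) powr (1 / \<alpha>)" by simp
    also have "\<dots> = - ln v" using v v1 alpha by (simp add: powr_powr)
    finally show "v = exp (- ((ln (real n) / \<rho>) powr (1 / \<alpha>)))"
      using v by (simp add: l_def)
  }
  {
    assume v: "v = exp (- ((ln (real n) / \<rho>) powr (1 / \<alpha>)))"
    have v1: "0 < v" "v < 1" using v l rho by (auto simp: l_def[symmetric])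
    have "(- ln v) powr \<alpha> = ((l / \<rho>) powr (1 / \<alpha>)) powr \<alpha>" using v by (simp add: l_def)
    also have "\<dots> = l / \<rho>" using l rho alpha by (simp add: powr_powr)
    finally have "\<rho> * (- ln v) powr \<alpha> = l" using rho by simp
    then show "0 < v \<and> real n * cdf (distr (M n) borel (X n e)) v = 1"
      using cdf_weight[OF assms(2), of v] v1 l by (simp add: exp_minus)
  }
qed

section \<open>First moment bounds for light paths\<close>

lemma laplace:
  assumes n: "n \<ge> 2" and e: "e \<in> complete_edges n" and x0: "ln (real n) + \<eta> / s n \<ge> 0"
  shows "(\<integral>\<^sup>+\<omega>. ennreal (exp (- (exp (\<eta> - 1) / (s n * u n)) * X n e \<omega>)) \<partial>M n)
    \<le> ennreal ((ln (real n) + \<eta> / s n + 1) * exp (- (ln (real n) + \<eta> / s n)))"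
proof -
  define \<theta> where "\<theta> = exp (\<eta> - 1) / (s n * u n)"
  have "(\<integral>\<^sup>+\<omega>. ennreal (exp (- \<theta> * X n e \<omega>)) \<partial>M n)
      = (\<integral>\<^sup>+y. ennreal (exp (- \<theta> * y)) \<partial>distr (M n) borel (X n e))"
    using rv[OF e] by (subst nn_integral_distr) auto
  also have "\<dots> = (\<integral>\<^sup>+\<omega>. ennreal (exp (- \<theta> * exp (- ((E \<omega> / \<rho>) powr (1 / \<alpha>))))) \<partial>N)"
    unfolding law[OF e] by (subst nn_integral_distr) auto
  also have "\<dots> \<le> ennreal ((ln (real n) + \<eta> / s n + 1) * exp (- (ln (real n) + \<eta> / s n)))"
    unfolding \<theta>_def u_eq[OF n] using x0 rho alpha n unfolding s_def
    by (intro prob_space.laplace_weight_le[OF prob_N _ _ _ _ exp_E]) auto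
  finally show ?thesis by (simp add: \<theta>_def)
qed

text \<open>The exponent collects \<open>c * exp \<eta>\<close> from the Markov factor, -1 from the
  factor \<open>1 / n\<close>, and \<open>- R * \<eta>\<close> from the power of \<phi>; the last
  summand is the error due to the polynomial factor in \<phi>. The 2 in the hypothesis on
  \<open>I\<close> is spent on a convergent geometric series over the lengths.\<close>

lemma prob_light_event_le:
  fixes \<eta> c R :: real
  assumes n: "n \<ge> 2" and x0: "ln (real n) + \<eta> / s n \<ge> 0"
  defines "\<phi> \<equiv> (ln (real n) + \<eta> / s n + 1) * exp (- (\<eta> / s n))"
  assumes I: "\<And>k. k \<in> I \<Longrightarrow> (2 * \<phi>) ^ k \<le> (2 * \<phi>) powr (R * h n)"
  shows "measure (M n) (light_event n I (c * exp 1 * (u n * s n * ln (real n))))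
    \<le> exp (ln (real n) * (c * exp \<eta> - 1 - R * \<eta> + R * (s n * ln (2 * (ln (real n) + \<eta> / s n + 1)))))"
proof -
  interpret prob_space "M n" by (rule prob_M)
  define \<theta> where "\<theta> = exp (\<eta> - 1) / (s n * u n)"
  define l where "l = ln (real n)"
  have l: "l > 0" "real n = exp l" using n by (auto simp: l_def)
  have su: "s n > 0" "u n > 0" using n by (auto intro: s_pos u_pos)
  have phi: "\<phi> > 0" unfolding \<phi>_def using x0 by (intro mult_pos_pos) auto
  have "measure (M n) (light_event n I (c * exp 1 * (u n * s n * l)))
      \<le> exp (\<theta> * (c * exp 1 * (u n * s n * l))) / n * (\<Sum>k\<in>I \<inter> {1..n}. \<phi> ^ k)"
  proof (rule prob_light_path_le[OF indep])
    fix e assume e: "e \<in> complete_edges n"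
    have "\<phi> / n = (ln (real n) + \<eta> / s n + 1) * exp (- (ln (real n) + \<eta> / s n))"
      using n by (simp add: \<phi>_def exp_diff exp_minus field_simps)
    then show "(\<integral>\<^sup>+\<omega>. ennreal (exp (- \<theta> * X n e \<omega>)) \<partial>M n) \<le> ennreal (\<phi> / n)"
      using laplace[OF n e x0] by (simp add: \<theta>_def)
  qed (use n su phi in \<open>auto simp: \<theta>_def\<close>)
  also have "exp (\<theta> * (c * exp 1 * (u n * s n * l))) / n = exp (l * (c * exp \<eta> - 1))"
    using su l by (simp add: \<theta>_def exp_diff algebra_simps)
  \<comment> \<open>Writing \<phi> as half of \<open>2 * \<phi>\<close> replaces the length
    dependence by the summable weights \<open>(1 / 2) ^ k\<close>.\<close>
  also have "(\<Sum>k\<in>I \<inter> {1..n}. \<phi> ^ k) \<le> (\<Sum>k\<in>I \<inter> {1..n}. (2 * \<phi>) powr (R * h n) * (1 / 2) ^ k)"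
  proof (rule sum_mono)
    fix k assume "k \<in> I \<inter> {1..n}"
    then have "(2 * \<phi>) ^ k * (1 / 2) ^ k \<le> (2 * \<phi>) powr (R * h n) * (1 / 2) ^ k"
      using I by (intro mult_right_mono) auto
    then show "\<phi> ^ k \<le> (2 * \<phi>) powr (R * h n) * (1 / 2) ^ k"
      by (simp add: power_mult_distrib power_divide)
  qed
  also have "\<dots> \<le> (2 * \<phi>) powr (R * h n)"
  proof -
    have "(\<Sum>k\<in>I \<inter> {1..n}. (1 / 2 :: real) ^ k) \<le> (\<Sum>k\<in>{1..n}. (1 / 2) ^ k)"
      by (intro sum_mono2) auto
    also have "\<dots> = 1 - (1 / 2) ^ n"
      by (induction n) auto
    also have "\<dots> \<le> 1" by simp
    finally have "(2 * \<phi>) powr (R * h n) * (\<Sum>k\<in>I \<inter> {1..n}. (1 / 2 :: real) ^ k)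
        \<le> (2 * \<phi>) powr (R * h n) * 1"
      by (intro mult_left_mono) auto
    then show ?thesis by (simp add: sum_distrib_left)
  qed
  also have "(2 * \<phi>) powr (R * h n)
      = exp (l * (- R * \<eta> + R * (s n * ln (2 * (l + \<eta> / s n + 1)))))"
  proof -
    define T where "T = ln (2 * (l + \<eta> / s n + 1))"
    have *: "ln (2 * \<phi>) = T - \<eta> / s n" unfolding T_def
      unfolding \<phi>_def l_def[symmetric] mult.assoc[symmetric]
      using x0 by (subst ln_mult_pos) (auto simp: l_def)
    have "R * h n * ln (2 * \<phi>) = l * (- R * \<eta> + R * (s n * T))"
      unfolding * l_def[symmetric] using su by (simp add: field_simps)
    then show ?thesis using phi by (simp add: powr_def T_def)
  qed
  finally show ?thesis
    unfolding l_def[symmetric] by (simp add: exp_add[symmetric] algebra_simps mult_left_mono)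
qed

lemma ln_at_top: "filterlim (\<lambda>n. ln (real n)) at_top sequentially"
  by real_asymp

lemma beta: "0 < 1 / \<alpha>" "1 / \<alpha> < 1" "1 / (\<alpha> * \<rho> powr (1 / \<alpha>)) > 0"
  using rho alpha by auto

lemma h_at_top: "filterlim h at_top sequentially"
  unfolding s_def by (rule filterlim_compose[OF scale_asymptotics(1)[OF beta(3,1,2)] ln_at_top])

lemma s_tendsto_0: "s \<longlonglongrightarrow> 0"
  unfolding s_def[abs_def]
  by (rule filterlim_compose[OF scale_asymptotics(3)[OF beta(3,1,2)] ln_at_top])

lemma s_ln_tendsto_0: "D > 0 \<Longrightarrow> (\<lambda>n. s n * ln (D * ln (real n) + D')) \<longlonglongrightarrow> 0"
  unfolding s_def[abs_def]
  by (rule filterlim_compose[OF scale_asymptotics(2)[OF beta(3,1,2)] ln_at_top])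

lemma h_square_tendsto_0: "(\<lambda>n. (h n + 1)\<^sup>2 / real n) \<longlonglongrightarrow> 0"
  unfolding s_def[abs_def] by (rule scale_asymptotics(4)[OF beta(3,1,2)])

text \<open>The sign of \<eta> decides the direction: for \<open>\<eta> > 0\<close> eventually
  \<open>2 * \<phi> \<le> 1\<close> and long paths are unlikely, for \<open>\<eta> < 0\<close>
  instead \<open>2 * \<phi> \<ge> 1\<close> and short paths are. In both cases
  \<open>R * h n\<close> is the worst exponent. Half of the negative exponent absorbs the error
  term.\<close>

lemma light_event_tendsto_0:
  fixes \<eta> c R :: real
  assumes neg: "c * exp \<eta> - 1 - R * \<eta> < 0"
    and I: "\<And>n k. k \<in> I n \<Longrightarrow> (\<eta> > 0 \<and> R * h n \<le> k) \<or> (\<eta> < 0 \<and> k \<le> R * h n)"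
  shows "(\<lambda>n. measure (M n) (light_event n (I n) (c * exp 1 * (u n * s n * ln (real n))))) \<longlonglongrightarrow> 0"
proof -
  define \<delta> where "\<delta> = - (c * exp \<eta> - 1 - R * \<eta>)"
  have \<delta>: "\<delta> > 0" using neg by (simp add: \<delta>_def)
  define x0 where "x0 n = ln (real n) + \<eta> / s n" for n
  define t where "t n = s n * ln (2 * (x0 n + 1))" for n
  \<comment> \<open>Since \<open>h n\<close> is \<open>s n\<close> times ln n, this says that 1 / s
    and |\<eta>| / s are at most ln n, which makes \<open>x0\<close> nonnegative and of order ln
    n.\<close>
  have evh: "eventually (\<lambda>n. max 1 \<bar>\<eta>\<bar> \<le> h n) sequentially"
    using h_at_top by (simp only: filterlim_at_top)
  have bds: "eventually (\<lambda>n. 0 \<le> x0 n \<and> x0 n \<le> ln (real n) * (1 + \<bar>\<eta>\<bar>)) sequentially"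
    using evh eventually_ge_at_top[of 2]
  proof eventually_elim
    case (elim n)
    have s: "s n > 0" using elim by (intro s_pos)
    have "\<bar>\<eta>\<bar> / s n \<le> ln (real n)" using elim s by (simp add: field_simps)
    moreover have "- \<eta> / s n \<le> \<bar>\<eta>\<bar> / s n" using s by (intro divide_right_mono) auto
    moreover have "1 / s n \<le> ln (real n)" using elim s by (simp add: field_simps)
    then have "\<bar>\<eta>\<bar> * (1 / s n) \<le> \<bar>\<eta>\<bar> * ln (real n)" by (intro mult_left_mono) auto
    moreover have "\<eta> / s n \<le> \<bar>\<eta>\<bar> / s n" using s by (intro divide_right_mono) auto
    ultimately show ?case by (simp add: x0_def algebra_simps)
  qed
  have t: "t \<longlonglongrightarrow> 0"
  proof (rule tendsto_sandwich[OF _ _ tendsto_const s_ln_tendsto_0[of "2 * (1 + \<bar>\<eta>\<bar>)" 2]])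
    show "eventually (\<lambda>n. 0 \<le> t n) sequentially"
      using bds eventually_ge_at_top[of 2]
      by eventually_elim (auto simp: t_def intro!: mult_nonneg_nonneg less_imp_le[OF s_pos])
    show "eventually (\<lambda>n. t n \<le> s n * ln (2 * (1 + \<bar>\<eta>\<bar>) * ln (real n) + 2)) sequentially"
      using bds eventually_ge_at_top[of 2]
    proof eventually_elim
      case (elim n)
      then have "ln (2 * (x0 n + 1)) \<le> ln (2 * (1 + \<bar>\<eta>\<bar>) * ln (real n) + 2)"
        by (subst ln_le_cancel_iff) (auto simp: algebra_simps intro!: add_nonneg_pos)
      then show ?case unfolding t_def using s_pos[of n] elim by (intro mult_left_mono) auto
    qed
  qed simp
  have "(\<lambda>n. R * t n) \<longlonglongrightarrow> 0" using tendsto_mult_left[OF t, of R] by simp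
  then have ev1: "eventually (\<lambda>n. R * t n < \<delta> / 2) sequentially"
    using \<delta> by (intro order_tendstoD) auto
  \<comment> \<open>Equivalent to \<open>2 * (x0 n + 1) < exp (\<eta> / s n)\<close>, hence to
    \<open>2 * \<phi> < 1\<close>.\<close>
  have ev2: "eventually (\<lambda>n. \<eta> > 0 \<longrightarrow> t n < \<eta>) sequentially"
    using order_tendstoD(2)[OF t, of \<eta>] by (cases "\<eta> > 0") auto
  have bound: "eventually (\<lambda>n. measure (M n) (light_event n (I n) (c * exp 1 * (u n * s n * ln (real n))))
      \<le> exp (ln (real n) * (- \<delta> / 2))) sequentially"
    using bds ev1 ev2 eventually_ge_at_top[of 2]
  proof eventually_elim
    case (elim n)
    define \<phi> where "\<phi> = (x0 n + 1) * exp (- (\<eta> / s n))"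
    have s: "s n > 0" using elim by (intro s_pos)
    have phi: "\<phi> > 0" unfolding \<phi>_def using elim by (intro mult_pos_pos) auto
    have "measure (M n) (light_event n (I n) (c * exp 1 * (u n * s n * ln (real n))))
        \<le> exp (ln (real n) * (c * exp \<eta> - 1 - R * \<eta> + R * (s n * ln (2 * (ln (real n) + \<eta> / s n + 1)))))"
    proof (rule prob_light_event_le)
      fix k assume k: "k \<in> I n"
      have "(2 * \<phi>) powr real k \<le> (2 * \<phi>) powr (R * h n)"
        using I[OF k]
      proof
        assume *: "\<eta> > 0 \<and> R * h n \<le> real k"
        have "s n * ln (2 * (x0 n + 1)) < s n * (\<eta> / s n)"
          using elim * s by (simp add: t_def)
        then have "ln (2 * (x0 n + 1)) \<le> \<eta> / s n" using s by (simp only: mult_less_cancel_left_pos)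
        then have "exp (ln (2 * (x0 n + 1))) \<le> exp (\<eta> / s n)" by (simp only: exp_le_cancel_iff)
        then have "2 * (x0 n + 1) \<le> exp (\<eta> / s n)" using elim by simp
        then have "2 * \<phi> \<le> 1" by (simp add: \<phi>_def exp_minus field_simps)
        then show ?thesis using * phi by (intro powr_mono') auto
      next
        assume *: "\<eta> < 0 \<and> real k \<le> R * h n"
        have "1 \<le> exp (- (\<eta> / s n))" using * s by (simp add: divide_nonpos_pos)
        then have "1 * 1 \<le> (x0 n + 1) * exp (- (\<eta> / s n))" using elim by (intro mult_mono) auto
        then show ?thesis using * by (intro powr_mono) (auto simp: \<phi>_def)
      qed
      then show "(2 * ((ln (real n) + \<eta> / s n + 1) * exp (- (\<eta> / s n)))) ^ k
          \<le> (2 * ((ln (real n) + \<eta> / s n + 1) * exp (- (\<eta> / s n)))) powr (R * h n)"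
        using phi by (simp add: powr_realpow \<phi>_def x0_def)
    qed (use elim in \<open>auto simp: x0_def\<close>)
    also have "\<dots> \<le> exp (ln (real n) * (- \<delta> / 2))"
    proof -
      have "c * exp \<eta> - 1 - R * \<eta> + R * t n \<le> - \<delta> / 2" using elim by (simp add: \<delta>_def)
      then show ?thesis using elim(4) unfolding t_def x0_def
        by (subst exp_le_cancel_iff) (intro mult_left_mono, auto)
    qed
    finally show ?case .
  qed
  have "(\<lambda>n. exp (ln (real n) * (- \<delta> / 2))) \<longlonglongrightarrow> 0" using \<delta> by real_asymp
  then show ?thesis
    using tendsto_sandwich[OF _ bound tendsto_const, of 0] by simp
qed

section \<open>Second moment upper bound for the minimal weight\<close>

lemma scale_A: "n \<ge> 2 \<Longrightarrow> (ln (real n) / \<rho>) powr (1 / \<alpha>) = \<alpha> * h n"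
  using rho alpha unfolding s_def by (subst scale_eq) auto

text \<open>The left side is the logarithm of n times the probability that an edge has weight at
  most \<open>b * u n\<close>. To first order it is \<open>ln b / s n\<close>; as
  \<open>ln b > 1\<close>, the midpoint of 1 and \<open>ln b\<close> is a valid slope that still
  exceeds 1.\<close>

lemma log_degree_lower_bound:
  assumes b: "b > exp 1"
  shows "eventually (\<lambda>n. b * u n < 1 \<and>
    ln (real n) - \<rho> * (- ln (b * u n)) powr \<alpha> \<ge> (1 + ln b) / 2 / s n) sequentially"
proof -
  have b0: "b > 0" using b exp_gt_zero[of 1] by linarith
  then have lb: "ln b > 1" using b ln_less_cancel_iff[of "exp 1" b] by simp
  define \<gamma> where "\<gamma> = (1 + ln b) / 2"
  have gam: "\<gamma> < ln b" using lb by (simp add: \<gamma>_def)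
  define A where "A n = \<alpha> * h n" for n
  have A: "filterlim A at_top sequentially"
    unfolding A_def using alpha by (intro filterlim_tendsto_pos_mult_at_top[OF tendsto_const _ h_at_top]) auto
  have A_pos: "eventually (\<lambda>n. A n > ln b) sequentially" using A by (simp add: filterlim_at_top_dense)
  have z: "filterlim (\<lambda>n. ln b / A n) (at 0) sequentially"
    unfolding filterlim_at
  proof
    show "((\<lambda>n. ln b / A n) \<longlongrightarrow> 0) sequentially"
      by (rule tendsto_divide_0[OF tendsto_const filterlim_at_top_imp_at_infinity[OF A]])
    show "eventually (\<lambda>n. ln b / A n \<in> UNIV \<and> ln b / A n \<noteq> 0) sequentially"
      using A_pos by eventually_elim (use lb in auto)
  qed
  \<comment> \<open>The expansion is taken along z = ln b / A, which tends to 0 because A = - ln u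
    diverges.\<close>
  have "((\<lambda>z::real. (1 - z) powr \<alpha>) has_real_derivative - \<alpha>) (at 0)"
    by (auto intro!: derivative_eq_intros)
  then have "((\<lambda>z::real. ((1 - z) powr \<alpha> - 1) / z) \<longlongrightarrow> - \<alpha>) (at 0)"
    by (simp add: has_field_derivative_iff)
  then have "eventually (\<lambda>z::real. ((1 - z) powr \<alpha> - 1) / z < - (\<gamma> * \<alpha> / ln b)) (at 0)"
    using gam lb alpha by (intro order_tendstoD) (auto simp: field_simps)
  then have "eventually (\<lambda>n. ((1 - ln b / A n) powr \<alpha> - 1) / (ln b / A n) < - (\<gamma> * \<alpha> / ln b)) sequentially"
    using z by (rule eventually_compose_filterlim)
  then show ?thesis using A_pos eventually_ge_at_top[of 2]
  proof eventually_elim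
    case (elim n)
    define l where "l = ln (real n)"
    have l: "l > 0" using elim by (simp add: l_def)
    have s: "s n > 0" using elim by (intro s_pos)
    have Aeq: "A n = (l / \<rho>) powr (1 / \<alpha>)" using scale_A[of n] elim by (simp add: A_def l_def)
    have u: "u n = exp (- A n)" using elim u_eq[of n] by (simp add: Aeq l_def)
    have A0: "A n > 0" using elim lb by linarith
    have bu: "- ln (b * u n) = A n - ln b" using b0 by (simp add: u ln_mult)
    have "ln (b * u n) < 0" using bu elim by simp
    then have 1: "b * u n < 1" using b0 by (simp add: u)
    have "\<rho> * (- ln (b * u n)) powr \<alpha> = \<rho> * (A n * (1 - ln b / A n)) powr \<alpha>"
      using A0 by (simp add: bu right_diff_distrib)
    also have "\<dots> = \<rho> * (A n powr \<alpha> * (1 - ln b / A n) powr \<alpha>)"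
      using A0 elim by (subst powr_mult) (auto simp: field_simps)
    also have "A n powr \<alpha> = l / \<rho>" using l rho alpha by (simp add: Aeq powr_powr)
    finally have 2: "\<rho> * (- ln (b * u n)) powr \<alpha> = l * (1 - ln b / A n) powr \<alpha>"
      using rho by simp
    have "(1 - ln b / A n) powr \<alpha> - 1 < - (\<gamma> * \<alpha> / ln b) * (ln b / A n)"
      using elim(1) lb A0 by (subst (asm) pos_divide_less_eq) auto
    also have "\<dots> = - (\<gamma> * \<alpha> / A n)" using lb by simp
    finally have "l * (\<gamma> * \<alpha> / A n) \<le> l * (1 - (1 - ln b / A n) powr \<alpha>)"
      using l by (intro mult_left_mono) auto
    moreover have "l * (\<gamma> * \<alpha> / A n) = \<gamma> / s n"
      using l s alpha by (simp add: A_def l_def field_simps)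
    ultimately have "\<gamma> / s n \<le> l - \<rho> * (- ln (b * u n)) powr \<alpha>"
      unfolding 2 by (simp add: algebra_simps)
    then show ?case using 1 by (simp add: \<gamma>_def l_def)
  qed
qed

text \<open>If \<open>Suc k\<close> edges all had weight at most \<open>b * u n\<close>, their path
  would weigh at most \<open>Suc k * (b * u n)\<close>; a larger minimum therefore forces a heavy
  edge on every such path.\<close>

lemma prob_heavy_le:
  fixes b p :: real and m k n :: nat
  assumes n: "n \<ge> 2" and b: "0 < b * u n" "b * u n < 1"
  defines "p \<equiv> exp (- (\<rho> * (- ln (b * u n)) powr \<alpha>))"
  assumes "m * p \<ge> 4" "8 * k \<le> m" "2 + k * m \<le> n"
  shows "measure (M n) {\<omega> \<in> space (M n). Suc k * (b * u n) < min_weight n (\<lambda>e. X n e \<omega>)}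
    \<le> m / (m * p) ^ Suc k + 6 / (m * p) + 4 * k / m"
proof -
  interpret prob_space "M n" by (rule prob_M)
  let ?S = "{\<omega> \<in> space (M n). \<forall>q\<in>self_avoiding_paths n 1 2.
      length (path_edges q) = Suc k \<longrightarrow> (\<exists>e\<in>set (path_edges q). X n e \<omega> > b * u n)}"
  have "measure (M n) {\<omega> \<in> space (M n). Suc k * (b * u n) < min_weight n (\<lambda>e. X n e \<omega>)} \<le> measure (M n) ?S"
  proof (rule finite_measure_mono)
    show "?S \<in> sets (M n)"
    proof (rule sets.sets_Collect_finite_All[OF _ finite_self_avoiding_paths])
      fix q assume q: "q \<in> self_avoiding_paths n 1 2"
      have "{\<omega> \<in> space (M n). \<exists>e\<in>set (path_edges q). X n e \<omega> > b * u n} \<in> sets (M n)"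
      proof (rule sets.sets_Collect_finite_Ex)
        fix e assume "e \<in> set (path_edges q)"
        then have "X n e \<in> borel_measurable (M n)" using q by (intro rv) (auto simp: self_avoiding_paths_def)
        then show "{\<omega> \<in> space (M n). X n e \<omega> > b * u n} \<in> sets (M n)" by measurable
      qed simp
      then show "{\<omega> \<in> space (M n). length (path_edges q) = Suc k \<longrightarrow>
          (\<exists>e\<in>set (path_edges q). X n e \<omega> > b * u n)} \<in> sets (M n)"
        by (cases "length (path_edges q) = Suc k") simp_all
    qed
    show "{\<omega> \<in> space (M n). Suc k * (b * u n) < min_weight n (\<lambda>e. X n e \<omega>)} \<subseteq> ?S"
    proof safe
      fix \<omega> q assume less: "Suc k * (b * u n) < min_weight n (\<lambda>e. X n e \<omega>)"
        and q: "q \<in> self_avoiding_paths n 1 2" "length (path_edges q) = Suc k"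
      show "\<exists>e\<in>set (path_edges q). b * u n < X n e \<omega>"
      proof (rule ccontr)
        assume "\<not> (\<exists>e\<in>set (path_edges q). b * u n < X n e \<omega>)"
        then have "path_weight (\<lambda>e. X n e \<omega>) q \<le> sum_list (map (\<lambda>e. b * u n) (path_edges q))"
          unfolding path_weight_def by (intro sum_list_mono) auto
        also have "\<dots> = Suc k * (b * u n)" using q(2) by (simp add: sum_list_triv)
        finally show False using less min_weight_le[OF q(1), of "\<lambda>e. X n e \<omega>"] by linarith
      qed
    qed
  qed
  also have "\<dots> \<le> m / (m * p) ^ Suc k + 6 / (m * p) + 4 * k / m"
    using assms prob_weight_le[OF _ b]
    by (intro prob_no_light_layered_path[OF indep]) (auto simp: p_def)
  finally show ?thesis .
qed

text \<open>The paths have K = \<lceil>h\<rceil> edges, hence K - 1 layers. The mean number of light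
  edges from a vertex into a layer is at least exp (\<gamma> / s) with \<gamma> > 1, so its K-th
  power is at least n to the power \<gamma>. This beats the layer size, which is at most n; the
  other errors are of order s and (h + 1)^2 / n.\<close>

lemma heavy_tendsto_0:
  assumes b: "b > exp 1"
  shows "(\<lambda>n. measure (M n) {\<omega> \<in> space (M n).
    real (nat \<lceil>h n\<rceil>) * (b * u n) < min_weight n (\<lambda>e. X n e \<omega>)}) \<longlonglongrightarrow> 0"
proof -
  have b0: "b > 0" using b exp_gt_zero[of 1] by linarith
  then have lb: "ln b > 1" using b ln_less_cancel_iff[of "exp 1" b] by simp
  define g where "g = (1 + ln b) / 2"
  \<comment> \<open>The gap between \<gamma> and \<open>g\<close> pays for cutting the vertex set
    into layers.\<close>
  define \<gamma> where "\<gamma> = (1 + g) / 2"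
  have gam: "1 < \<gamma>" "\<gamma> < g" using lb by (auto simp: \<gamma>_def g_def)
  have ev_s: "eventually (\<lambda>n. s n < 1 / 4) sequentially"
    using s_tendsto_0 by (rule order_tendstoD) simp
  have ev_ln: "eventually (\<lambda>n. s n * ln (2 * ln (real n) + 2) < g - \<gamma>) sequentially"
    using s_ln_tendsto_0[of 2 2] gam by (intro order_tendstoD) auto
  have ev_h: "eventually (\<lambda>n. 1 \<le> h n) sequentially"
    using h_at_top by (simp only: filterlim_at_top)
  have ev_sq: "eventually (\<lambda>n. (h n + 1)\<^sup>2 / real n < 1 / 16) sequentially"
    using h_square_tendsto_0 by (rule order_tendstoD) simp
  have bound: "eventually (\<lambda>n. measure (M n) {\<omega> \<in> space (M n).
      real (nat \<lceil>h n\<rceil>) * (b * u n) < min_weight n (\<lambda>e. X n e \<omega>)}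
      \<le> exp (ln (real n) * (1 - \<gamma>)) + 6 * s n + 8 * ((h n + 1)\<^sup>2 / real n)) sequentially"
    using log_degree_lower_bound[OF b] ev_s ev_ln ev_h ev_sq eventually_ge_at_top[of 8]
  proof eventually_elim
    case (elim n)
    define l where "l = ln (real n)"
    define K where "K = nat \<lceil>h n\<rceil>"
    define k where "k = K - 1"
    \<comment> \<open>Dividing by \<open>K\<close> instead of \<open>k\<close> still leaves room for
      all layers and is meaningful when \<open>k = 0\<close>.\<close>
    define m where "m = (n - 2) div K"
    define p where "p = exp (- (\<rho> * (- ln (b * u n)) powr \<alpha>))"
    have n: "n \<ge> 2" "real n = exp l" and l: "l > 0" using elim by (auto simp: l_def)
    have s: "s n > 0" and u: "u n > 0" using n by (auto intro: s_pos u_pos)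
    have K: "h n \<le> K" "K \<le> h n + 1" "K \<ge> 1"
      using elim(4) unfolding K_def by linarith+
    have Suck: "Suc k = K" using K by (simp add: k_def)
    have "real K * real K \<le> (h n + 1) * (h n + 1)" using K by (intro mult_mono) auto
    then have Ksq: "(real K)\<^sup>2 \<le> (h n + 1)\<^sup>2" by (simp add: power2_eq_square)
    also have "\<dots> < n / 16" using elim(5) n by (simp add: field_simps)
    finally have Ksq16: "16 * (real K)\<^sup>2 \<le> n" by simp
    have "real K \<le> (real K)\<^sup>2" using K by (simp add: power2_eq_square)
    with Ksq16 have K16: "16 * real K \<le> n" by linarith
    have m_lower: "real n / (2 * real K) \<le> m"
    proof -
      have "n - 2 = K * m + (n - 2) mod K" by (simp add: m_def)
      moreover have "(n - 2) mod K < K" using K by simp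
      ultimately have "real n \<le> K * m + K + 2" using n by (simp flip: of_nat_mult of_nat_add)
      then have "real n / 2 \<le> K * m" using K16 elim(6) by simp
      then show ?thesis using K by (simp add: field_simps)
    qed
    have m_pos: "real m > 0"
    proof -
      have "0 < real n / (2 * real K)" using K n by simp
      then show ?thesis using m_lower by linarith
    qed
    have "8 * real K \<le> n / (2 * real K)" using Ksq16 K by (simp add: field_simps power2_eq_square)
    then have "8 * real K \<le> m" using m_lower by linarith
    then have k8: "8 * k \<le> m" unfolding k_def by linarith
    have "k * m \<le> K * m" by (simp add: k_def)
    also have "\<dots> \<le> n - 2" by (simp add: m_def)
    finally have kn: "2 + k * m \<le> n" using n by simp
    have m_upper: "real m \<le> n" unfolding m_def
      by (rule of_nat_mono) (metis div_le_dividend diff_le_self order_trans)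
    have mu: "exp (\<gamma> / s n) \<le> m * p"
    proof -
      \<comment> \<open>A layer holds at least the fraction \<open>1 / (2 * K)\<close> of n. The
        loss \<open>ln (2 * K)\<close> is only of order ln ln n, hence below
        \<open>(g - \<gamma>) / s n\<close>.\<close>
      have "h n \<le> l" using elim(2) l by (simp add: l_def mult_le_cancel_right1)
      then have "ln (2 * real K) \<le> ln (2 * l + 2)" using K l by (subst ln_le_cancel_iff) auto
      also have "\<dots> \<le> (g - \<gamma>) / s n" using elim(3) s by (simp add: l_def field_simps)
      finally have "\<gamma> / s n \<le> g / s n - ln (2 * real K)" by (simp add: diff_divide_distrib)
      also have "\<dots> \<le> l - \<rho> * (- ln (b * u n)) powr \<alpha> - ln (2 * real K)"
        using elim(1) by (simp add: g_def l_def)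
      finally have "exp (\<gamma> / s n) \<le> exp (l - \<rho> * (- ln (b * u n)) powr \<alpha> - ln (2 * real K))"
        by simp
      also have "\<dots> = exp (l - \<rho> * (- ln (b * u n)) powr \<alpha>) / (2 * real K)"
        using K by (subst exp_diff) simp
      also have "exp (l - \<rho> * (- ln (b * u n)) powr \<alpha>) = n * p"
        unfolding p_def n(2) by (simp flip: exp_add)
      also have "n * p / (2 * real K) = n / (2 * real K) * p" by simp
      also have "\<dots> \<le> m * p" using m_lower by (intro mult_right_mono) (auto simp: p_def)
      finally show ?thesis .
    qed
    have s_inv: "1 / s n \<le> exp (\<gamma> / s n)"
    proof -
      have "1 / s n \<le> \<gamma> / s n" using gam s by (intro divide_right_mono) auto
      also have "\<dots> \<le> exp (\<gamma> / s n)" using exp_ge_add_one_self[of "\<gamma> / s n"] by linarith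
      finally show ?thesis .
    qed
    have "4 \<le> 1 / s n" using elim(2) s by (simp add: field_simps)
    then have mu4: "m * p \<ge> 4" using mu s_inv by linarith
    have mus: "1 / s n \<le> m * p" using mu s_inv by linarith
    have "measure (M n) {\<omega> \<in> space (M n). Suc k * (b * u n) < min_weight n (\<lambda>e. X n e \<omega>)}
        \<le> m / (m * p) ^ Suc k + 6 / (m * p) + 4 * k / m"
      using n u b0 elim(1) mu4 k8 kn unfolding p_def by (intro prob_heavy_le) auto
    also have "m / (m * p) ^ Suc k \<le> exp (l * (1 - \<gamma>))"
    proof -
      have "exp (l * \<gamma>) \<le> exp (\<gamma> / s n) ^ K"
      proof -
        \<comment> \<open>Rounding \<open>h n\<close> up makes the power large enough:
          \<open>K \<ge> h n\<close> turns the degree bound into n to the power \<gamma>.\<close>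
        have "l * \<gamma> = \<gamma> / s n * h n" using s by (simp add: l_def)
        also have "\<dots> \<le> \<gamma> / s n * K" using K gam s by (intro mult_left_mono) auto
        finally show ?thesis by (simp add: exp_of_nat_mult[symmetric] mult.commute)
      qed
      also have "\<dots> \<le> (m * p) ^ K" using mu by (intro power_mono) auto
      finally have "m / (m * p) ^ K \<le> n / exp (l * \<gamma>)"
        using m_upper by (intro frac_le) auto
      then show ?thesis using n by (simp add: Suck exp_diff algebra_simps)
    qed
    also have "6 / (m * p) \<le> 6 * s n" 
    proof -
      have "6 / (m * p) \<le> 6 / (1 / s n)" using mus s by (intro frac_le) auto
      then show ?thesis by simp
    qed
    also have "4 * k / m \<le> 8 * ((h n + 1)\<^sup>2 / real n)"
    proof -
      have "4 * k / m \<le> 4 * K / (real n / (2 * real K))"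
        using m_lower K n by (intro frac_le) (auto simp: k_def)
      also have "\<dots> = 8 * ((real K)\<^sup>2 / n)" by (simp add: power2_eq_square)
      also have "\<dots> \<le> 8 * ((h n + 1)\<^sup>2 / n)"
        using Ksq by (intro mult_left_mono divide_right_mono) auto
      finally show ?thesis .
    qed
    finally show ?case by (simp add: Suck K_def[symmetric] l_def)
  qed
  have "(\<lambda>n. exp (ln (real n) * (1 - \<gamma>))) \<longlonglongrightarrow> 0" using gam by real_asymp
  then have "(\<lambda>n. exp (ln (real n) * (1 - \<gamma>)) + 6 * s n + 8 * ((h n + 1)\<^sup>2 / real n)) \<longlonglongrightarrow> 0 + 6 * 0 + 8 * 0"
    by (intro tendsto_intros s_tendsto_0 h_square_tendsto_0)
  then show ?thesis
    using tendsto_sandwich[OF _ bound tendsto_const, of 0] by simp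
qed

section \<open>Limits of the minimal weight and of the hopcount\<close>

lemma min_weight_measurable [measurable]: "(\<lambda>\<omega>. min_weight n (\<lambda>e. X n e \<omega>)) \<in> borel_measurable (M n)"
  by (rule measurable_min_weight[OF rv])

lemma hopcount_measurable [measurable]: "(\<lambda>\<omega>. real (hopcount n (\<lambda>e. X n e \<omega>))) \<in> borel_measurable (M n)"
  by (rule measurable_hopcount[OF rv])

text \<open>An intermediate \<open>b\<close> between e and \<open>c\<close> absorbs the rounding:
  \<open>(h n + 1) * b \<le> c * h n\<close> once \<open>h n \<ge> b / (c - b)\<close>.\<close>

lemma min_weight_upper_tendsto_0:
  assumes c: "c > exp 1"
  shows "(\<lambda>n. measure (M n) {\<omega> \<in> space (M n).
    c * (u n * s n * ln (real n)) < min_weight n (\<lambda>e. X n e \<omega>)}) \<longlonglongrightarrow> 0"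
proof -
  obtain b where b: "exp 1 < b" "b < c" using dense[OF c] by blast
  have b0: "b > 0" using b exp_gt_zero[of 1] by linarith
  have "eventually (\<lambda>n. b / (c - b) \<le> h n) sequentially"
    using h_at_top by (simp only: filterlim_at_top)
  then have bound: "eventually (\<lambda>n. measure (M n) {\<omega> \<in> space (M n).
        c * (u n * s n * ln (real n)) < min_weight n (\<lambda>e. X n e \<omega>)}
      \<le> measure (M n) {\<omega> \<in> space (M n).
        real (nat \<lceil>h n\<rceil>) * (b * u n) < min_weight n (\<lambda>e. X n e \<omega>)}) sequentially"
    using eventually_ge_at_top[of 2]
  proof eventually_elim
    case (elim n)
    interpret prob_space "M n" by (rule prob_M)
    have u: "u n > 0" using elim by (intro u_pos)
    have "h n > 0" using elim s_pos[of n] by simp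
    then have "real (nat \<lceil>h n\<rceil>) \<le> h n + 1" by linarith
    then have "real (nat \<lceil>h n\<rceil>) * (b * u n) \<le> (h n + 1) * (b * u n)"
      using b0 u by (intro mult_right_mono) auto
    also have "\<dots> \<le> c * h n * u n"
    proof -
      have "(h n + 1) * b \<le> c * h n" using elim(1) b by (simp add: field_simps)
      then show ?thesis using u by (simp add: mult.assoc[symmetric])
    qed
    finally have "real (nat \<lceil>h n\<rceil>) * (b * u n) \<le> c * (u n * s n * ln (real n))"
      by (simp add: mult_ac)
    then show ?case by (intro finite_measure_mono) auto
  qed
  show ?thesis
    using tendsto_sandwich[OF _ bound tendsto_const heavy_tendsto_0[OF b(1)]] by simp
qed

text \<open>The lower tail is a first moment event over paths of all lengths, the upper tail is the
  second moment bound.\<close>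

lemma min_weight_tendsto:
  "tendsto_in_prob M (\<lambda>n \<omega>. min_weight n (\<lambda>e. X n e \<omega>) / (u n * s n * ln (real n))) (exp 1)"
  unfolding tendsto_in_prob_def
proof (intro conjI allI impI)
  fix \<epsilon> :: real assume eps: "\<epsilon> > 0"
  \<comment> \<open>The maximum keeps \<open>c\<close> positive for large \<epsilon>. The choice of
    \<eta> makes \<open>c * exp \<eta>\<close> the square root of \<open>c\<close>, which is below
    1, so the exponent with R = 0 is negative.\<close>
  define c where "c = max (1 / 2) (1 - \<epsilon> / exp 1)"
  define \<eta> where "\<eta> = - ln c / 2"
  have c: "0 < c" "c < 1" "(1 - \<epsilon> / exp 1) \<le> c"
    using eps unfolding c_def by (simp_all only: less_max_iff_disj max_less_iff_conj max.cobounded2) simp_all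
  have ln_c: "ln c < 0" using c by simp
  have "c * exp \<eta> = exp (ln c / 2)"
  proof -
    have "c * exp \<eta> = exp (ln c + \<eta>)" using c by (simp only: exp_add) simp
    then show ?thesis by (simp add: \<eta>_def)
  qed
  then have neg: "c * exp \<eta> - 1 - 0 * \<eta> < 0" using ln_c by simp
  let ?L = "\<lambda>n. measure (M n) (light_event n UNIV (c * exp 1 * (u n * s n * ln (real n))))"
  let ?U = "\<lambda>n. measure (M n) {\<omega> \<in> space (M n).
    (exp 1 + \<epsilon>) * (u n * s n * ln (real n)) < min_weight n (\<lambda>e. X n e \<omega>)}"
  have L: "?L \<longlonglongrightarrow> 0"
    using ln_c by (intro light_event_tendsto_0[OF neg]) (auto simp: \<eta>_def)
  have U: "?U \<longlonglongrightarrow> 0" using eps by (intro min_weight_upper_tendsto_0) simp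
  have LU: "(\<lambda>n. ?L n + ?U n) \<longlonglongrightarrow> 0" using tendsto_add[OF L U] by simp
  have bound: "eventually (\<lambda>n. measure (M n) {\<omega> \<in> space (M n).
      \<bar>min_weight n (\<lambda>e. X n e \<omega>) / (u n * s n * ln (real n)) - exp 1\<bar> > \<epsilon>} \<le> ?L n + ?U n) sequentially"
    using eventually_ge_at_top[of 2]
  proof eventually_elim
    case (elim n)
    interpret prob_space "M n" by (rule prob_M)
    define w where "w = u n * s n * ln (real n)"
    have w: "w > 0" unfolding w_def using elim s_pos[of n] u_pos[of n] by simp
    have "measure (M n) {\<omega> \<in> space (M n). \<bar>min_weight n (\<lambda>e. X n e \<omega>) / w - exp 1\<bar> > \<epsilon>}
      \<le> measure (M n) (light_event n UNIV (c * exp 1 * w) \<union>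
          {\<omega> \<in> space (M n). (exp 1 + \<epsilon>) * w < min_weight n (\<lambda>e. X n e \<omega>)})"
    proof (rule finite_measure_mono)
      show "{\<omega> \<in> space (M n). \<bar>min_weight n (\<lambda>e. X n e \<omega>) / w - exp 1\<bar> > \<epsilon>}
        \<subseteq> light_event n UNIV (c * exp 1 * w) \<union>
          {\<omega> \<in> space (M n). (exp 1 + \<epsilon>) * w < min_weight n (\<lambda>e. X n e \<omega>)}"
      proof safe
        fix \<omega> assume *: "\<bar>min_weight n (\<lambda>e. X n e \<omega>) / w - exp 1\<bar> > \<epsilon>"
          "\<not> (exp 1 + \<epsilon>) * w < min_weight n (\<lambda>e. X n e \<omega>)"
        obtain p where p: "p \<in> self_avoiding_paths n 1 2"
          "path_weight (\<lambda>e. X n e \<omega>) p = min_weight n (\<lambda>e. X n e \<omega>)"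
          using hopcount_minimal[OF elim] by blast
        have "min_weight n (\<lambda>e. X n e \<omega>) / w \<le> exp 1 + \<epsilon>" using *(2) w by (simp add: field_simps)
        with *(1) have "min_weight n (\<lambda>e. X n e \<omega>) / w \<le> exp 1 - \<epsilon>" by linarith
        also have "\<dots> = exp 1 * (1 - \<epsilon> / exp 1)" by (simp add: field_simps)
        also have "\<dots> \<le> exp 1 * c" using c by (intro mult_left_mono) auto
        finally have "min_weight n (\<lambda>e. X n e \<omega>) \<le> c * exp 1 * w" using w by (simp add: field_simps)
        with p show "\<exists>p\<in>self_avoiding_paths n 1 2. length (path_edges p) \<in> UNIV \<and>
            path_weight (\<lambda>e. X n e \<omega>) p \<le> c * exp 1 * w"
          by (intro bexI[of _ p]) simp_all
      qed
    qed (intro sets.Un sets_light_event, measurable)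
    also have "\<dots> \<le> ?L n + ?U n"
      unfolding w_def by (intro measure_Un_le sets_light_event) measurable
    finally show ?case by (simp add: w_def)
  qed
  show "(\<lambda>n. measure (M n) {\<omega> \<in> space (M n).
      \<bar>min_weight n (\<lambda>e. X n e \<omega>) / (u n * s n * ln (real n)) - exp 1\<bar> > \<epsilon>}) \<longlonglongrightarrow> 0"
    using tendsto_sandwich[OF _ bound tendsto_const LU] by simp
qed measurable

text \<open>The exponent of the first-moment bound is minimised at \<open>\<eta> = ln R\<close>.\<close>

lemma light_event_ratio_exponent:
  fixes R :: real
  assumes "R > 0" "R \<noteq> 1"
  obtains c where "c > 1" "\<And>c'. c' \<le> c \<Longrightarrow> c' * exp (ln R) - 1 - R * ln R < 0"
proof -
  \<comment> \<open>Strictness for \<open>R \<noteq> 1\<close> makes the exponent negative already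
    at c = 1 and leaves room for some c > 1.\<close>
  have "ln (1 / R) < 1 / R - 1" 
    using assms ln_le_minus_one[of "1 / R"] ln_eq_minus_one[of "1 / R"] by fastforce
  then have "- ln R * R < (1 / R - 1) * R"
    using assms by (intro mult_strict_right_mono) (auto simp: ln_div)
  then have "R < 1 + R * ln R" using assms by (simp add: algebra_simps)
  then have "1 < (1 + R * ln R) / R" using assms by (simp add: field_simps)
  then obtain c where c: "1 < c" "c < (1 + R * ln R) / R" using dense by blast
  have "c' * exp (ln R) - 1 - R * ln R < 0" if "c' \<le> c" for c'
  proof -
    have "c' * R \<le> c * R" using that assms by (intro mult_right_mono) auto
    moreover have "c * R < 1 + R * ln R" using c assms by (simp add: field_simps)
    ultimately have "c' * R - 1 - R * ln R < 0" by linarith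
    then show ?thesis using assms by simp
  qed
  with c show ?thesis using that by blast
qed

text \<open>Either the minimal path weighs more than \<open>c\<close> times its predicted weight, or
  it is light with too many or too few edges. All three events have vanishing probability.\<close>

lemma hopcount_tendsto:
  "tendsto_in_prob M (\<lambda>n \<omega>. real (hopcount n (\<lambda>e. X n e \<omega>)) / (s n * ln (real n))) 1"
  unfolding tendsto_in_prob_def
proof (intro conjI allI impI)
  fix \<epsilon> :: real assume eps: "\<epsilon> > 0"
  \<comment> \<open>The cap keeps the ratio \<open>1 - \<delta>\<close> positive, as its logarithm
    is used as \<eta>.\<close>
  define \<delta> where "\<delta> = min \<epsilon> (1 / 2)"
  have \<delta>: "0 < \<delta>" "\<delta> < 1" "\<delta> \<le> \<epsilon>" using eps by (auto simp: \<delta>_def)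
  obtain c1 where c1: "c1 > 1" "\<And>c'. c' \<le> c1 \<Longrightarrow> c' * exp (ln (1 + \<delta>)) - 1 - (1 + \<delta>) * ln (1 + \<delta>) < 0"
    using light_event_ratio_exponent[of "1 + \<delta>"] \<delta> by auto
  obtain c2 where c2: "c2 > 1" "\<And>c'. c' \<le> c2 \<Longrightarrow> c' * exp (ln (1 - \<delta>)) - 1 - (1 - \<delta>) * ln (1 - \<delta>) < 0"
    using light_event_ratio_exponent[of "1 - \<delta>"] \<delta> by auto
  \<comment> \<open>One weight threshold has to serve both length ranges and still exceed 1 for the
    upper bound on the minimal weight.\<close>
  define c where "c = min c1 c2"
  have c: "c > 1" "c \<le> c1" "c \<le> c2" using c1 c2 by (auto simp: c_def)
  define I1 where "I1 n = {k. (1 + \<delta>) * h n \<le> real k}" for n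
  define I2 where "I2 n = {k. real k \<le> (1 - \<delta>) * h n}" for n
  let ?w = "\<lambda>n. c * exp 1 * (u n * s n * ln (real n))"
  let ?A = "\<lambda>n. measure (M n) (light_event n (I1 n) (?w n))"
  let ?B = "\<lambda>n. measure (M n) (light_event n (I2 n) (?w n))"
  let ?C = "\<lambda>n. measure (M n) {\<omega> \<in> space (M n). ?w n < min_weight n (\<lambda>e. X n e \<omega>)}"
  have A: "?A \<longlonglongrightarrow> 0"
    using \<delta> by (intro light_event_tendsto_0[OF c1(2)[OF c(2)]]) (auto simp: I1_def)
  have B: "?B \<longlonglongrightarrow> 0"
    using \<delta> by (intro light_event_tendsto_0[OF c2(2)[OF c(3)]]) (auto simp: I2_def)
  have C: "?C \<longlonglongrightarrow> 0"
    using c by (intro min_weight_upper_tendsto_0) auto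
  have ABC: "(\<lambda>n. ?A n + ?B n + ?C n) \<longlonglongrightarrow> 0"
    using tendsto_add[OF tendsto_add[OF A B] C] by simp
  have bound: "eventually (\<lambda>n. measure (M n) {\<omega> \<in> space (M n).
      \<bar>real (hopcount n (\<lambda>e. X n e \<omega>)) / h n - 1\<bar> > \<epsilon>} \<le> ?A n + ?B n + ?C n) sequentially"
    using eventually_ge_at_top[of 2]
  proof eventually_elim
    case (elim n)
    interpret prob_space "M n" by (rule prob_M)
    have hn: "h n > 0" using elim s_pos[of n] by simp
    let ?CE = "{\<omega> \<in> space (M n). ?w n < min_weight n (\<lambda>e. X n e \<omega>)}"
    have meas: "?CE \<in> sets (M n)" by measurable
    have "measure (M n) {\<omega> \<in> space (M n). \<bar>real (hopcount n (\<lambda>e. X n e \<omega>)) / h n - 1\<bar> > \<epsilon>}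
      \<le> measure (M n) (light_event n (I1 n) (?w n) \<union> light_event n (I2 n) (?w n) \<union> ?CE)"
    proof (rule finite_measure_mono)
      show "{\<omega> \<in> space (M n). \<bar>real (hopcount n (\<lambda>e. X n e \<omega>)) / h n - 1\<bar> > \<epsilon>}
        \<subseteq> light_event n (I1 n) (?w n) \<union> light_event n (I2 n) (?w n) \<union> ?CE"
      proof
        fix \<omega> assume "\<omega> \<in> {\<omega> \<in> space (M n). \<bar>real (hopcount n (\<lambda>e. X n e \<omega>)) / h n - 1\<bar> > \<epsilon>}"
        then have om: "\<omega> \<in> space (M n)"
          and dev: "\<bar>real (hopcount n (\<lambda>e. X n e \<omega>)) / h n - 1\<bar> > \<epsilon>" by auto
        obtain p where p: "p \<in> self_avoiding_paths n 1 2"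
          "path_weight (\<lambda>e. X n e \<omega>) p = min_weight n (\<lambda>e. X n e \<omega>)"
          "length (path_edges p) = hopcount n (\<lambda>e. X n e \<omega>)"
          using hopcount_minimal[OF elim] by blast
        have "1 + \<delta> \<le> real (hopcount n (\<lambda>e. X n e \<omega>)) / h n
            \<or> real (hopcount n (\<lambda>e. X n e \<omega>)) / h n \<le> 1 - \<delta>"
          using dev \<delta>(3) by linarith
        then have "length (path_edges p) \<in> I1 n \<or> length (path_edges p) \<in> I2 n"
          unfolding p(3) I1_def I2_def mem_Collect_eq pos_le_divide_eq[OF hn] pos_divide_le_eq[OF hn] .
        then show "\<omega> \<in> light_event n (I1 n) (?w n) \<union> light_event n (I2 n) (?w n) \<union> ?CE"
          using om p(1,2) not_less[of "?w n" "min_weight n (\<lambda>e. X n e \<omega>)"] by auto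
      qed
    qed (intro sets.Un sets_light_event meas)
    also have "\<dots> \<le> measure (M n) (light_event n (I1 n) (?w n) \<union> light_event n (I2 n) (?w n)) + ?C n"
      by (intro measure_Un_le sets.Un sets_light_event meas)
    also have "\<dots> \<le> ?A n + ?B n + ?C n"
      by (intro add_right_mono measure_Un_le sets_light_event)
    finally show ?case .
  qed
  show "(\<lambda>n. measure (M n) {\<omega> \<in> space (M n).
      \<bar>real (hopcount n (\<lambda>e. X n e \<omega>)) / (s n * ln (real n)) - 1\<bar> > \<epsilon>}) \<longlonglongrightarrow> 0"
    using tendsto_sandwich[OF _ bound tendsto_const ABC] by simp
qed measurable

end

theorem theorem1p2:
  fixes \<rho> \<alpha> :: real
    and N :: "'b measure" and E :: "'b \<Rightarrow> real"
    and M :: "nat \<Rightarrow> 'a measure" and X :: "nat \<Rightarrow> nat set \<Rightarrow> 'a \<Rightarrow> real"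
    and F :: "nat \<Rightarrow> real \<Rightarrow> real"
    and u s :: "nat \<Rightarrow> real"
  assumes rho: "\<rho> > 0" and alpha: "\<alpha> > 2"
    and prob_N: "prob_space N"
    and exp_E: "distributed N lborel E (exponential_density 1)"
    and prob_M: "\<And>n. prob_space (M n)"
    and indep: "\<And>n. prob_space.indep_vars (M n) (\<lambda>_. borel) (X n) (complete_edges n)"
    and law: "\<And>n e. e \<in> complete_edges n \<Longrightarrow>
      distr (M n) borel (X n e) = distr N borel (\<lambda>\<omega>. exp (- ((E \<omega> / \<rho>) powr (1 / \<alpha>))))"
    and F: "\<And>n e. e \<in> complete_edges n \<Longrightarrow> F n = cdf (distr (M n) borel (X n e))"
    and u: "\<And>n. u n = critical_value n (F n)"
    and s: "\<And>n. s n = 1 / (\<alpha> * \<rho> powr (1 / \<alpha>)) * ln (real n) powr (- 1 + 1 / \<alpha>)"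
  shows "(\<forall>n\<ge>2. (\<exists>!v. 0 < v \<and> real n * F n v = 1) \<and>
                 u n = exp (- ((ln (real n) / \<rho>) powr (1 / \<alpha>)))) \<and>
         tendsto_in_prob M
           (\<lambda>n \<omega>. min_weight n (\<lambda>e. X n e \<omega>) / (u n * s n * ln (real n))) (exp 1) \<and>
         tendsto_in_prob M
           (\<lambda>n \<omega>. real (hopcount n (\<lambda>e. X n e \<omega>)) / (s n * ln (real n))) 1"
proof -
  define v where "v n = exp (- ((ln (real n) / \<rho>) powr (1 / \<alpha>)))" for n :: nat
  have alpha1: "\<alpha> > 1" using alpha by simp
  \<comment> \<open>The closed form is used first, to solve the equation defining the critical
    value. Once \<open>u\<close> is known to agree with it from n = 2 on, the second interpretation
    yields the limits for \<open>u\<close> itself.\<close>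
  interpret v: exp_power_weights \<rho> \<alpha> N E M X s v
    by (intro exp_power_weights.intro) (rule rho alpha1 prob_N exp_E prob_M indep s v_def | erule law)+
  have crit: "0 < x \<and> real n * F n x = 1 \<longleftrightarrow> x = v n" if "n \<ge> 2" for n x
  proof -
    have e: "{1, 2} \<in> complete_edges n" using that by (auto simp: complete_edges_def)
    show ?thesis using v.critical_value[OF that e, of x] F[OF e] by (simp add: v_def)
  qed
  have uv: "u n = v n" if "n \<ge> 2" for n
    unfolding u critical_value_def crit[OF that] by simp
  interpret exp_power_weights \<rho> \<alpha> N E M X s u
    by (intro exp_power_weights.intro)
      (rule rho alpha1 prob_N exp_E prob_M indep s | erule law | simp only: uv v_def)+
  have "\<forall>n\<ge>2. (\<exists>!x. 0 < x \<and> real n * F n x = 1) \<and> u n = exp (- ((ln (real n) / \<rho>) powr (1 / \<alpha>)))"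
    using crit uv by (simp add: v_def)
  then show ?thesis using min_weight_tendsto hopcount_tendsto by blast
qed

end
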